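(* Let $A\in\mathbb{R}^{m\times n}$ (not assumed to have full rank), $b\in\mathbb{R}^m$, $c\in\mathbb{R}^n$, and assume that there exists a strictly feasible point, i.e. $(x,y,z)\in\mathbb{R}^{n+m+n}$ with $x>0$, $z>0$, $Ax=b$ and $A^Ty+z=c$. Fix parameters $\omega\gg 1$, $\epsilon,\epsilon_p,\epsilon_d,\gamma_p,\gamma_d>0$, $\gamma\in(0,1)$, $0<\beta_1<\beta_2<\beta_3<1$, $\tau_1,\tau_2\in(0,1]$ with $\beta_1+\tau_1-1>0$ and $\beta_1+\tau_2-1>0$, and a starting point $(x^0,y^0,z^0)\in\mathcal{N}$. Then for all sufficiently small regularization parameters $\rho>0$ and $\delta>0$ (that is, there exist $\rho_0,\delta_0>0$ such that for all $\rho\in(0,\rho_0]$ and $\delta\in(0,\delta_0]$), the regularized inexact interior-point method described in the context terminates (at step 1 or step 4) after a finite number of iterations, whatever admissible inexact search directions and step-lengths are chosen in the course of the algorithm.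
   Context: Setting: the primal linear program $\min c^Tx$ subject to $Ax=b$, $x\ge 0$, and its dual $\max b^Ty$ subject to $A^Ty+z=c$, $z\ge 0$. Inequalities between vectors are componentwise, $\|\cdot\|$ is the Euclidean norm, $\|\cdot\|_1$ the $1$-norm, $e=(1,\dots,1)^T\in\mathbb{R}^n$, $X^k=\mathrm{diag}(x^k)$, $Z^k=\mathrm{diag}(z^k)$. Upper indices denote iteration numbers, lower indices denote components. A point $(x,y,z)\in\mathbb{R}^{n+m+n}$ is an $(\epsilon,\epsilon_p,\epsilon_d)$-solution if $(x,z)\ge 0$, $x^Tz\le\epsilon$, $\|Ax-b\|\le\epsilon_p$ and $\|A^Ty+z-c\|\le\epsilon_d$. The central-path neighborhood $\mathcal{N}$ is the set of all $(x,y,z)\in\mathbb{R}^{n+m+n}$ such that - $(x,z)>0$; - $x_iz_i\ge\gamma\, x^Tz/n$ for $i=1,\dots,n$; - $x^Tz\ge\gamma_p\|Ax-b\|$ or $\|Ax-b\|\le\epsilon_p$; - $x^Tz\ge\gamma_d\|A^Ty+z-c\|$ or $\|A^Ty+z-c\|\le\epsilon_d$. The algorithm (regularized inexact interior-point method) with regularization parameters $\rho,\delta$: starting from $(x^0,y^0,z^0)\in\mathcal{N}$, for $k=0,1,2,\dots$ do: 1. If $(x^k,y^k,z^k)$ is an $(\epsilon,\epsilon_p,\epsilon_d)$-solution or $\|(x^k,z^k)\|_1>\omega$, STOP. 2. Compute any (inexact) search direction $(\Delta x^k,\Delta y^k,\Delta z^k)$ satisfying $$\begin{pmatrix} A & \delta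 I & 0\\ -\rho I & A^T & I\\ Z^k & 0 & X^k\end{pmatrix}\begin{pmatrix}\Delta x^k\\ \Delta y^k\\ \Delta z^k\end{pmatrix}=\begin{pmatrix} b-Ax^k\\ c-A^Ty^k-z^k\\ \beta_1\mu_k e-X^kz^k\end{pmatrix}+\begin{pmatrix} r^k\\ s^k\\ 0\end{pmatrix},\qquad \mu_k=\frac{(x^k)^Tz^k}{n},$$ for some residual components $r^k\in\mathbb{R}^m$, $s^k\in\mathbb{R}^n$ with $\|r^k\|\le(1-\tau_1)\|Ax^k-b\|$ and $\|s^k\|\le(1-\tau_2)\|A^Ty^k+z^k-c\|$. 3. Let $\alpha^{*,k}=\min\{\alpha_p^{*,k},\alpha_d^{*,k}\}$ with $\alpha_p^{*,k}=\max\{\alpha\in\mathbb{R}: x^k+\alpha\Delta x^k\ge 0\}$ and $\alpha_d^{*,k}=\max\{\alpha\in\mathbb{R}: z^k+\alpha\Delta z^k\ge 0\}$ (a maximum over a set unbounded above being read as $+\infty$). 4. If $(x^k,y^k,z^k)+\alpha^{*,k}(\Delta x^k,\Delta y^k,\Delta z^k)$ is an $(\epsilon,\epsilon_p,\epsilon_d)$-solution, STOP (this test is regarded as failing if $\alpha^{*,k}=+\infty$). 5. Let $\bar\alpha^k$ be the largest value in $[0,1]$ such that for all $\alpha\in[0,\bar\alpha^k]$: $(x^k,y^k,z^k)+\alpha(\Delta x^k,\Delta y^k,\Delta z^k)\in\mathcal{N}$ and $(x^k+\alpha\Delta x^k)^T(z^k+\alpha\Delta z^k)\le(1-\alpha(1-\beta_2))(x^k)^Tz^k$.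 6. Choose any $\alpha_p^k,\alpha_d^k\in[0,1]$ such that, with $(x^{k+1},y^{k+1},z^{k+1})=(x^k+\alpha_p^k\Delta x^k,\;y^k+\alpha_d^k\Delta y^k,\;z^k+\alpha_d^k\Delta z^k)$, one has $(x^{k+1},y^{k+1},z^{k+1})\in\mathcal{N}$ and $(x^{k+1})^Tz^{k+1}\le(1-\bar\alpha^k(1-\beta_3))(x^k)^Tz^k$. (The choice $\alpha_p^k=\alpha_d^k=\bar\alpha^k$ is always admissible.) *)

theory Defs
  imports "HOL-Analysis.Analysis"
begin

text \<open>A point is a triple \<open>(x, y, z)\<close> with \<open>x\<close>, \<open>z\<close> indexed by \<open>'n\<close> and \<open>y\<close> indexed by \<open>'m\<close>;
  sums and scalar multiples of points are the componentwise ones of the product space.\<close>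

type_synonym ('n, 'm) point = "(real ^ 'n) \<times> (real ^ 'm) \<times> (real ^ 'n)"

definition norm1 :: "real ^ 'n::finite \<Rightarrow> real" where
  "norm1 v = (\<Sum>i\<in>UNIV. \<bar>v $ i\<bar>)"

definition diag :: "real ^ 'n::finite \<Rightarrow> real ^ 'n ^ 'n" where
  "diag v = (\<chi> i j. if i = j then v $ i else 0)"

definition nonneg_vec :: "real ^ 'n::finite \<Rightarrow> bool" where
  "nonneg_vec v \<longleftrightarrow> (\<forall>i. 0 \<le> v $ i)"

text \<open>The library order on vectors makes \<open>0 < v\<close> weaker than positivity of every component.\<close>

definition pos_vec :: "real ^ 'n::finite \<Rightarrow> bool" where
  "pos_vec v \<longleftrightarrow> (\<forall>i. 0 < v $ i)"

fun gap :: "('n::finite, 'm::finite) point \<Rightarrow> real" where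
  "gap (x, y, z) = x \<bullet> z"

text \<open>The maximum of a set of reals, read as \<open>\<infinity>\<close> when the set is unbounded above.\<close>

definition max_or_infinity :: "real set \<Rightarrow> ereal" where
  "max_or_infinity S = (if bdd_above S then ereal (GREATEST a. a \<in> S) else \<infinity>)"

text \<open>The step to the boundary along \<open>dv\<close>, and the smaller one of those for \<open>x\<close> and for \<open>z\<close>.\<close>

definition max_step :: "real ^ 'n::finite \<Rightarrow> real ^ 'n \<Rightarrow> ereal" where
  "max_step v dv = max_or_infinity {\<alpha>. nonneg_vec (v + \<alpha> *\<^sub>R dv)}"

fun alpha_star :: "('n::finite, 'm::finite) point \<Rightarrow> ('n, 'm) point \<Rightarrow> ereal" where
  "alpha_star (x, y, z) (dx, dy, dz) = min (max_step x dx) (max_step z dz)"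

definition strictly_feasible ::
  "real ^ 'n::finite ^ 'm::finite \<Rightarrow> real ^ 'm \<Rightarrow> real ^ 'n \<Rightarrow> ('n, 'm) point \<Rightarrow> bool" where
  "strictly_feasible A b c = (\<lambda>(x, y, z).
     pos_vec x \<and> pos_vec z \<and> A *v x = b \<and> transpose A *v y + z = c)"

text \<open>The locale only bundles the data and the parameters of the algorithm; it assumes nothing.\<close>

locale ipm =
  fixes A :: "real ^ 'n::finite ^ 'm::finite"
    and b :: "real ^ 'm"
    and c :: "real ^ 'n"
    and \<omega> \<epsilon> \<epsilon>\<^sub>p \<epsilon>\<^sub>d \<gamma> \<gamma>\<^sub>p \<gamma>\<^sub>d \<beta>\<^sub>1 \<beta>\<^sub>2 \<beta>\<^sub>3 \<tau>\<^sub>1 \<tau>\<^sub>2 \<rho> \<delta> :: real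
begin

definition is_solution :: "('n, 'm) point \<Rightarrow> bool" where
  "is_solution = (\<lambda>(x, y, z).
     nonneg_vec x \<and> nonneg_vec z \<and> x \<bullet> z \<le> \<epsilon> \<and>
     norm (A *v x - b) \<le> \<epsilon>\<^sub>p \<and> norm (transpose A *v y + z - c) \<le> \<epsilon>\<^sub>d)"

definition neighborhood :: "('n, 'm) point set" where
  "neighborhood = {(x, y, z).
     pos_vec x \<and> pos_vec z \<and>
     (\<forall>i. x $ i * z $ i \<ge> \<gamma> * (x \<bullet> z) / real CARD('n)) \<and>
     (x \<bullet> z \<ge> \<gamma>\<^sub>p * norm (A *v x - b) \<or> norm (A *v x - b) \<le> \<epsilon>\<^sub>p) \<and>
     (x \<bullet> z \<ge> \<gamma>\<^sub>d * norm (transpose A *v y + z - c) \<or> norm (transpose A *v y + z - c) \<le> \<epsilon>\<^sub>d)}"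

definition stops_at_step1 :: "('n, 'm) point \<Rightarrow> bool" where
  "stops_at_step1 = (\<lambda>(x, y, z). is_solution (x, y, z) \<or> norm1 x + norm1 z > \<omega>)"

definition search_direction :: "('n, 'm) point \<Rightarrow> ('n, 'm) point \<Rightarrow> bool" where
  "search_direction = (\<lambda>(x, y, z) (dx, dy, dz).
     \<exists>r s. norm r \<le> (1 - \<tau>\<^sub>1) * norm (A *v x - b) \<and>
           norm s \<le> (1 - \<tau>\<^sub>2) * norm (transpose A *v y + z - c) \<and>
           A *v dx + \<delta> *\<^sub>R dy = b - A *v x + r \<and>
           - (\<rho> *\<^sub>R dx) + transpose A *v dy + dz = c - transpose A *v y - z + s \<and>
           diag z *v dx + diag x *v dz =
             (\<beta>\<^sub>1 * (x \<bullet> z / real CARD('n))) *\<^sub>R vec 1 - diag x *v z)"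

definition stops_at_step4 :: "('n, 'm) point \<Rightarrow> ('n, 'm) point \<Rightarrow> bool" where
  "stops_at_step4 w d \<longleftrightarrow> (\<exists>a. alpha_star w d = ereal a \<and> is_solution (w + a *\<^sub>R d))"

definition alpha_bar :: "('n, 'm) point \<Rightarrow> ('n, 'm) point \<Rightarrow> real" where
  "alpha_bar w d = (GREATEST a. a \<in> {0..1} \<and>
     (\<forall>\<alpha>\<in>{0..a}. w + \<alpha> *\<^sub>R d \<in> neighborhood \<and>
        gap (w + \<alpha> *\<^sub>R d) \<le> (1 - \<alpha> * (1 - \<beta>\<^sub>2)) * gap w))"

definition next_iterate ::
  "('n, 'm) point \<Rightarrow> ('n, 'm) point \<Rightarrow> ('n, 'm) point \<Rightarrow> bool" where
  "next_iterate = (\<lambda>(x, y, z) (dx, dy, dz) w'.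
     (\<exists>\<alpha>\<^sub>p\<in>{0..1}. \<exists>\<alpha>\<^sub>d\<in>{0..1}. w' = (x + \<alpha>\<^sub>p *\<^sub>R dx, y + \<alpha>\<^sub>d *\<^sub>R dy, z + \<alpha>\<^sub>d *\<^sub>R dz)) \<and>
     w' \<in> neighborhood \<and>
     gap w' \<le> (1 - alpha_bar (x, y, z) (dx, dy, dz) * (1 - \<beta>\<^sub>3)) * gap (x, y, z))"

definition iteration ::
  "('n, 'm) point \<Rightarrow> ('n, 'm) point \<Rightarrow> ('n, 'm) point \<Rightarrow> bool" where
  "iteration w d w' \<longleftrightarrow>
     \<not> stops_at_step1 w \<and> search_direction w d \<and> \<not> stops_at_step4 w d \<and> next_iterate w d w'"

text \<open>Every execution from \<open>w\<^sub>0\<close> reaches a stop in step 1 or step 4 after finitely many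
  iterations: no sequence of admissible choices goes on forever, and an execution that has not
  stopped always has an admissible choice of direction and of step-lengths, so that it can only
  end through one of the two stopping tests.\<close>

definition terminates_from :: "('n, 'm) point \<Rightarrow> bool" where
  "terminates_from w\<^sub>0 \<longleftrightarrow>
     (\<forall>w d. w 0 = w\<^sub>0 \<longrightarrow> \<not> (\<forall>k::nat. iteration (w k) (d k) (w (Suc k)))) \<and>
     (\<forall>w d. \<forall>N::nat. w 0 = w\<^sub>0 \<and> (\<forall>k<N. iteration (w k) (d k) (w (Suc k))) \<and>
          \<not> stops_at_step1 (w N) \<longrightarrow>
        (\<exists>d\<^sub>N. search_direction (w N) d\<^sub>N) \<and>
        (\<forall>d\<^sub>N. search_direction (w N) d\<^sub>N \<and> \<not> stops_at_step4 (w N) d\<^sub>N \<longrightarrow>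
           (\<exists>w'. next_iterate (w N) d\<^sub>N w')))"

end

end

theory Submission
  imports Defs
begin

text \<open>While the algorithm runs, \<open>x\<^sup>T z\<close> stays above
  \<open>e = min \<epsilon> (min (\<gamma>\<^sub>p \<epsilon>\<^sub>p) (\<gamma>\<^sub>d \<epsilon>\<^sub>d))\<close>, so the components of \<open>x\<close> and \<open>z\<close> lie in a fixed
  interval \<open>[\<eta>, \<omega>]\<close> with \<open>\<eta> > 0\<close>. On this region \<open>\<Delta>x\<close>, \<open>\<Delta>z\<close> and the component of \<open>\<Delta>y\<close> in the
  range of \<open>A\<close> are bounded uniformly in \<open>\<rho>, \<delta> \<le> 1\<close>. The component of \<open>\<Delta>y\<close> orthogonal to the range
  may blow up as \<open>\<delta> \<rightarrow> 0\<close>, but since \<open>b\<close> lies in the range it exactly cancels the matching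
  component of the residual \<open>r\<close>; so regularization perturbs the infeasibilities after a full step
  only by \<open>O(\<delta>)\<close> and \<open>O(\<rho>)\<close>. Small \<open>\<rho>, \<delta>\<close> then allow a step-length bounded away from zero, and
  \<open>x\<^sup>T z\<close> would decrease geometrically below \<open>e\<close>. The maximal step-length of step 5 is attained unless
  the step hits the boundary, where the neighborhood inequalities force \<open>x\<^sup>T z = 0\<close> and the test of
  step 4 succeeds.\<close>

section \<open>Linear algebra around the range of \<open>A\<close>, and elementary estimates\<close>

lemma inner_transpose_mult:
  fixes A :: "real ^ 'n::finite ^ 'm::finite"
  shows "x \<bullet> (transpose A *v y) = (A *v x) \<bullet> y"
  by (metis dot_lmul_matrix inner_commute transpose_matrix_vector)

lemma diag_mult_nth [simp]: "(diag v *v u) $ i = v $ i * u $ i"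
  by (simp add: diag_def matrix_vector_mult_def if_distrib if_distribR sum.delta' cong: if_cong)

lemma inner_vec_sum: "x \<bullet> y = (\<Sum>i\<in>UNIV. x $ i * y $ i)" for x y :: "real ^ 'n::finite"
  by (simp add: inner_vec_def)

text \<open>For \<open>t > 1\<close> the constant \<open>p\<close> is dominated by
  \<open>p * t\<close>, and one factor \<open>t\<close> cancels; the summand 1 covers small
  \<open>t\<close>. This turns the energy inequality for \<open>norm dx\<close> into a
  bound.\<close>

lemma le_of_quadratic_le:
  fixes t :: real
  assumes "0 < d" "0 \<le> p" "0 \<le> q" "d * t\<^sup>2 \<le> p + q * t"
  shows "t \<le> 1 + (p + q) / d"
proof (cases "t \<le> 1")
  case True
  then show ?thesis using assms by (smt (verit) divide_nonneg_pos)
next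
  case False
  then have "p + q * t \<le> (p + q) * t"
    using assms mult_left_mono[of 1 t p] by (simp add: algebra_simps)
  then have "(d * t) * t \<le> (p + q) * t"
    using assms(4) by (simp add: power2_eq_square mult.assoc)
  then have "d * t \<le> p + q"
    using False by simp
  then show ?thesis
    using assms(1) by (simp add: field_simps)
qed

lemma norm_mult_components_le:
  fixes v u w :: "real ^ 'n::finite"
  assumes "\<And>i. v $ i = k i * u $ i" "\<And>i. \<bar>k i\<bar> \<le> c"
  shows "norm v \<le> c * norm u"
proof -
  have c: "0 \<le> c" using assms(2) by (meson abs_ge_zero order_trans)
  have "norm v \<le> norm (c *\<^sub>R u)"
    by (rule norm_le_componentwise_cart)
       (use c in \<open>auto simp: assms(1) abs_mult intro!: mult_right_mono assms(2)\<close>)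
  then show ?thesis using c by simp
qed

text \<open>The orthogonal complement of the range of \<open>A\<close> lies in the kernel of the
  transpose: for such \<open>v\<close>, the squared norm of \<open>transpose A *v v\<close> is the
  inner product of \<open>v\<close> with a vector of the range. As \<open>A\<close> may lack full
  rank, the dual equation controls only the component \<open>u\<close>.\<close>

lemma range_decomposition:
  fixes A :: "real ^ 'n::finite ^ 'm::finite"
  obtains u v where "dy = u + v" "u \<in> range ((*v) A)" "transpose A *v v = 0"
    "\<And>x. v \<bullet> (A *v x) = 0"
proof -
  have sub: "subspace (range ((*v) A))"
    by (simp add: linear_subspace_image)
  then have sp: "span (range ((*v) A)) = range ((*v) A)"
    by (rule span_eq_iff[THEN iffD2])
  obtain u v where uv: "u \<in> range ((*v) A)" "\<And>w. w \<in> range ((*v) A) \<Longrightarrow> orthogonal v w" "dy = u + v"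
    using orthogonal_subspace_decomp_exists[of "range ((*v) A)" dy] unfolding sp by blast
  have orth: "v \<bullet> (A *v x) = 0" for x
    using uv(2)[of "A *v x"] by (auto simp: orthogonal_def)
  have "(transpose A *v v) \<bullet> (transpose A *v v) = 0"
    unfolding inner_transpose_mult using orth by (simp add: inner_commute)
  then have "transpose A *v v = 0" by simp
  with uv orth show thesis using that by blast
qed

text \<open>If the transpose kills \<open>A *v x\<close>, then \<open>A *v x\<close> has norm 0. So
  the transpose is injective on the range, and an injective linear map on a finite-dimensional
  subspace is bounded below. This stands in for full rank.\<close>

lemma transpose_bounded_below_on_range:
  fixes A :: "real ^ 'n::finite ^ 'm::finite"
  obtains K where "0 < K" "\<And>u. u \<in> range ((*v) A) \<Longrightarrow> norm u \<le> K * norm (transpose A *v u)"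
proof -
  have sub: "subspace (range ((*v) A))"
    by (simp add: linear_subspace_image)
  have "\<forall>u\<in>range ((*v) A). transpose A *v u = 0 \<longrightarrow> u = 0"
  proof clarify
    fix x assume "transpose A *v (A *v x) = 0"
    then have "(A *v x) \<bullet> (A *v x) = 0"
      unfolding inner_transpose_mult[symmetric] by simp
    then show "A *v x = 0" by simp
  qed
  then obtain e where e: "e > 0" "\<And>u. u \<in> range ((*v) A) \<Longrightarrow> e * norm u \<le> norm (transpose A *v u)"
    using injective_imp_isometric[OF closed_subspace[OF sub] sub
        matrix_vector_mul_bounded_linear[of "transpose A"]] by auto
  show thesis
    by (rule that[of "1/e"]) (use e in \<open>auto simp: field_simps\<close>)
qed

section \<open>An a priori bound on search directions, uniform in the regularization\<close>

text \<open>An energy argument. Eliminating \<open>dz\<close> leaves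
  \<open>transpose A *v u = f - p + (\<rho> *\<^sub>R dx + q)\<close>, where \<open>q\<close> is a
  positive diagonal scaling of \<open>dx\<close>. Pairing the last bracket with \<open>dx\<close> is
  coercive, while pairing the left side with \<open>dx - h\<close> produces only
  \<open>r \<bullet> u\<close> minus a square. Together they give a quadratic inequality for
  \<open>norm dx\<close>. The third bound concerns the primal residual after a full step.\<close>

lemma uniform_direction_bound:
  fixes A :: "real ^ 'n::finite ^ 'm::finite"
  assumes xf: "A *v xf = b" and \<eta>: "0 < \<eta>" and \<omega>: "0 < \<omega>" and R: "0 \<le> R"
  obtains C where "0 < C"
    "\<And>\<rho> \<delta> x z dx dy dz r f g. \<lbrakk>0 \<le> \<rho>; \<rho> \<le> 1; 0 \<le> \<delta>; \<And>i. \<eta> \<le> x $ i; \<And>i. x $ i \<le> \<omega>;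
       \<And>i. \<eta> \<le> z $ i; \<And>i. z $ i \<le> \<omega>; norm r \<le> R; norm f \<le> R; norm g \<le> R;
       A *v dx + \<delta> *\<^sub>R dy = b - A *v x + r; - (\<rho> *\<^sub>R dx) + transpose A *v dy + dz = f;
       \<And>i. z $ i * dx $ i + x $ i * dz $ i = g $ i\<rbrakk>
     \<Longrightarrow> norm dx \<le> C \<and> norm dz \<le> C \<and> norm (r - \<delta> *\<^sub>R dy) \<le> norm r + \<delta> * C"
proof -
  obtain K where K: "0 < K" "\<And>u. u \<in> range ((*v) A) \<Longrightarrow> norm u \<le> K * norm (transpose A *v u)"
    using transpose_bounded_below_on_range[of A] by blast
  \<comment> \<open>The ratios \<open>z $ i / x $ i\<close> lie between \<open>1 / E\<close> and
    \<open>E\<close>; \<open>H\<close> bounds \<open>xf - x\<close> and \<open>B\<close> bounds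
    \<open>f - p\<close>. \<open>P\<close> and \<open>Q\<close> are the coefficients of the
    quadratic inequality, \<open>C0\<close> is the resulting bound on \<open>dx\<close>, and
    \<open>C\<close> adds up the bounds on \<open>dx\<close>, \<open>dz\<close> and
    \<open>u\<close>.\<close>
  define E where "E = \<omega> / \<eta>"
  define H where "H = norm xf + real CARD('n) * \<omega>"
  define B where "B = R + R / \<eta>"
  define P where "P = (R * K + H) * B"
  define Q where "Q = (R * K + H) * (1 + E) + B"
  define C0 where "C0 = 1 + (P + Q) / (1 / E)"
  define C where "C = C0 + (R / \<eta> + E * C0) + K * (B + (1 + E) * C0)"
  have E: "E > 0" and H: "H \<ge> 0" and B: "B \<ge> 0" and RE: "R / \<eta> \<ge> 0"
    using \<eta> \<omega> R by (auto simp: E_def H_def B_def)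
  have PQ: "P \<ge> 0" "Q \<ge> 0" using E H B K R by (auto simp: P_def Q_def)
  have C0: "C0 \<ge> 1" using PQ E by (simp add: C0_def)
  have C_ge: "C0 \<le> C" "R / \<eta> + E * C0 \<le> C" "K * (B + (1 + E) * C0) \<le> C"
    using E C0 RE K B by (simp_all add: C_def)
  show thesis
  proof (rule that[of C])
    show "0 < C" using C_ge C0 by linarith
    fix \<rho> \<delta> :: real and x z dx f g :: "real ^ 'n" and dz dy r
    assume \<rho>: "0 \<le> \<rho>" "\<rho> \<le> 1" and \<delta>: "0 \<le> \<delta>"
      and x: "\<And>i. \<eta> \<le> x $ i" "\<And>i. x $ i \<le> \<omega>" and z: "\<And>i. \<eta> \<le> z $ i" "\<And>i. z $ i \<le> \<omega>"
      and r: "norm r \<le> R" and f: "norm f \<le> R" and g: "norm g \<le> R"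
      and e1: "A *v dx + \<delta> *\<^sub>R dy = b - A *v x + r"
      and e2: "- (\<rho> *\<^sub>R dx) + transpose A *v dy + dz = f"
      and e3: "\<And>i. z $ i * dx $ i + x $ i * dz $ i = g $ i"
    have xpos: "0 < x $ i" "0 < z $ i" for i using x(1)[of i] z(1)[of i] \<eta> by linarith+
    obtain u v where uv: "dy = u + v" "u \<in> range ((*v) A)" "transpose A *v v = 0"
      "\<And>x. v \<bullet> (A *v x) = 0"
      using range_decomposition[of dy A] by blast
    \<comment> \<open>The third equation divided by \<open>x $ i\<close> reads
      \<open>dz = p - q\<close>; the shift \<open>h\<close> satisfies
      \<open>A *v h = b - A *v x\<close>.\<close>
    define p where "p = (\<chi> i. g $ i / x $ i)"
    define q where "q = (\<chi> i. z $ i / x $ i * dx $ i)"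
    define h where "h = xf - x"
    have dz: "dz = p - q"
    proof (rule vec_eq_iff[THEN iffD2], rule allI)
      fix i
      show "dz $ i = (p - q) $ i"
        using e3[of i] xpos[of i] by (simp add: p_def q_def field_simps)
    qed
    have Tu: "transpose A *v u = f - p + (\<rho> *\<^sub>R dx + q)"
    proof -
      have "transpose A *v dy = transpose A *v u"
        by (simp only: uv(1,3) matrix_vector_right_distrib add_0_right)
      then show ?thesis using e2 by (simp add: dz algebra_simps)
    qed
    have normp: "norm p \<le> R / \<eta>"
    proof -
      have "norm p \<le> (1 / \<eta>) * norm g"
      proof (rule norm_mult_components_le)
        show "p $ i = (1 / x $ i) * g $ i" for i by (simp add: p_def)
        show "\<bar>1 / x $ i\<bar> \<le> 1 / \<eta>" for i
          using x(1)[of i] \<eta> xpos[of i] by (simp add: frac_le)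
      qed
      also have "\<dots> \<le> (1 / \<eta>) * R" using g \<eta> by (intro mult_left_mono) auto
      finally show ?thesis by simp
    qed
    have normq: "norm q \<le> E * norm dx"
    proof (rule norm_mult_components_le)
      show "q $ i = (z $ i / x $ i) * dx $ i" for i by (simp add: q_def)
      show "\<bar>z $ i / x $ i\<bar> \<le> E" for i
        using x(1)[of i] z(2)[of i] \<eta> xpos[of i] by (simp add: E_def frac_le)
    qed
    have normh: "norm h \<le> H"
    proof -
      have "norm x \<le> (\<Sum>i\<in>UNIV. \<bar>x $ i\<bar>)" by (rule norm_le_l1_cart)
      also have "\<dots> \<le> (\<Sum>i\<in>(UNIV::'n set). \<omega>)"
        using x xpos by (intro sum_mono) (simp add: abs_of_pos)
      finally have "norm x \<le> real CARD('n) * \<omega>" by simp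
      then show ?thesis
        unfolding h_def H_def using norm_triangle_ineq4[of xf x] by linarith
    qed
    have fp: "norm (f - p) \<le> B"
      using norm_triangle_ineq4[of f p] f normp unfolding B_def by linarith
    have rq: "norm (\<rho> *\<^sub>R dx + q) \<le> (1 + E) * norm dx"
    proof -
      have "norm (\<rho> *\<^sub>R dx) \<le> norm dx" using \<rho> by (simp add: mult_left_le_one_le)
      then show ?thesis
        using norm_triangle_ineq[of "\<rho> *\<^sub>R dx" q] normq by (simp add: algebra_simps)
    qed
    have normTu: "norm (transpose A *v u) \<le> B + (1 + E) * norm dx"
      unfolding Tu using norm_triangle_ineq[of "f - p" "\<rho> *\<^sub>R dx + q"] fp rq by linarith
    \<comment> \<open>Primal regularization only adds \<rho> times a square, so the constant
      \<open>1 / E\<close> serves every \<rho>.\<close>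
    have coercive: "(1 / E) * (norm dx)\<^sup>2 \<le> dx \<bullet> (\<rho> *\<^sub>R dx + q)"
    proof -
      have "(1 / E) * (norm dx)\<^sup>2 = (\<Sum>i\<in>UNIV. (1 / E) * (dx $ i)\<^sup>2)"
        unfolding power2_norm_eq_inner inner_vec_sum by (simp add: sum_distrib_left power2_eq_square)
      also have "\<dots> \<le> (\<Sum>i\<in>UNIV. (z $ i / x $ i) * (dx $ i)\<^sup>2)"
      proof (intro sum_mono mult_right_mono)
        fix i show "1 / E \<le> z $ i / x $ i"
          using x(2)[of i] z(1)[of i] \<eta> xpos[of i] by (simp add: E_def frac_le)
      qed simp
      also have "\<dots> = dx \<bullet> q"
        by (simp add: q_def inner_vec_sum power2_eq_square algebra_simps)
      also have "\<dots> \<le> dx \<bullet> (\<rho> *\<^sub>R dx + q)"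
        using \<rho> by (simp add: inner_add_right)
      finally show ?thesis .
    qed
    \<comment> \<open>Since \<open>b\<close> is in the range of \<open>A\<close>, so is
      \<open>r - \<delta> *\<^sub>R dy\<close>, although \<open>r\<close> and \<open>dy\<close>
      separately need not be.\<close>
    have resid: "A *v (dx - h) = r - \<delta> *\<^sub>R dy"
      using e1 xf by (simp add: h_def matrix_vector_mult_diff_distrib algebra_simps)
    have energy: "(dx - h) \<bullet> (transpose A *v u) \<le> R * K * norm (transpose A *v u)"
    proof -
      have "(dx - h) \<bullet> (transpose A *v u) = (r - \<delta> *\<^sub>R dy) \<bullet> u"
        by (simp only: inner_transpose_mult resid)
      \<comment> \<open>The component \<open>v\<close> is orthogonal to \<open>u\<close>, and the
        remaining term in \<delta> has the favourable sign.\<close>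
      also have "\<dots> = r \<bullet> u - \<delta> * (u \<bullet> u)"
        using uv(2,4) by (auto simp: uv(1) inner_diff_left inner_add_left)
      also have "\<dots> \<le> r \<bullet> u" using \<delta> by simp
      also have "\<dots> \<le> norm r * norm u" by (rule norm_cauchy_schwarz)
      also have "\<dots> \<le> R * (K * norm (transpose A *v u))"
        using r K(2)[OF uv(2)] R by (intro mult_mono) auto
      finally show ?thesis by simp
    qed
    have "(1 / E) * (norm dx)\<^sup>2 \<le> P + Q * norm dx"
    proof -
      have "dx \<bullet> (\<rho> *\<^sub>R dx + q)
          = (dx - h) \<bullet> (transpose A *v u) - dx \<bullet> (f - p) + h \<bullet> (transpose A *v u)"
        unfolding Tu by (simp add: algebra_simps inner_diff_left inner_add_right)
      also have "\<dots> \<le> R * K * norm (transpose A *v u) + norm dx * B + H * norm (transpose A *v u)"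
      proof -
        have "- (dx \<bullet> (f - p)) \<le> norm dx * norm (f - p)"
          using norm_cauchy_schwarz[of "dx" "- (f - p)"] by (simp only: inner_minus_right norm_minus_cancel)
        also have "\<dots> \<le> norm dx * B" using fp by (intro mult_left_mono) auto
        finally have 1: "- (dx \<bullet> (f - p)) \<le> norm dx * B" .
        have "h \<bullet> (transpose A *v u) \<le> norm h * norm (transpose A *v u)"
          by (rule norm_cauchy_schwarz)
        also have "\<dots> \<le> H * norm (transpose A *v u)" using normh by (intro mult_right_mono) auto
        finally show ?thesis using 1 energy by linarith
      qed
      also have "\<dots> = (R * K + H) * norm (transpose A *v u) + norm dx * B"
        by (simp add: algebra_simps)
      also have "\<dots> \<le> (R * K + H) * (B + (1 + E) * norm dx) + norm dx * B"
        using normTu R K H by (intro add_right_mono mult_left_mono) auto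
      also have "\<dots> = P + Q * norm dx" by (simp add: P_def Q_def algebra_simps)
      finally show ?thesis using coercive by linarith
    qed
    then have dxC0: "norm dx \<le> C0"
      unfolding C0_def using PQ E by (intro le_of_quadratic_le) auto
    have "norm dz \<le> R / \<eta> + E * norm dx"
      unfolding dz using norm_triangle_ineq4[of p q] normp normq by linarith
    also have "\<dots> \<le> R / \<eta> + E * C0" using dxC0 E by simp
    finally have dzC: "norm dz \<le> C" using C_ge by linarith
    have "norm u \<le> K * norm (transpose A *v u)" by (rule K(2)[OF uv(2)])
    also have "\<dots> \<le> K * (B + (1 + E) * C0)"
    proof (rule mult_left_mono)
      have "(1 + E) * norm dx \<le> (1 + E) * C0" using dxC0 E by (intro mult_left_mono) auto
      then show "norm (transpose A *v u) \<le> B + (1 + E) * C0" using normTu by linarith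
    qed (use K in auto)
    finally have uC: "norm u \<le> C" using C_ge by linarith
    \<comment> \<open>The vector \<open>t\<close> lies in the range and differs from
      \<open>r - \<delta> *\<^sub>R u\<close> by a multiple of \<open>v\<close>. It is thus an
      orthogonal projection of that vector, and the uncontrolled \<open>v\<close> disappears from
      the estimate.\<close>
    have "norm (r - \<delta> *\<^sub>R dy) \<le> norm (r - \<delta> *\<^sub>R u)"
    proof -
      define t where "t = r - \<delta> *\<^sub>R dy"
      have "t \<bullet> v = 0" unfolding t_def resid[symmetric] using uv(4) by (simp add: inner_commute)
      then have "t \<bullet> t = t \<bullet> (r - \<delta> *\<^sub>R u)"
        unfolding t_def uv(1) by (simp add: inner_diff_right inner_add_right algebra_simps)
      also have "\<dots> \<le> norm t * norm (r - \<delta> *\<^sub>R u)" by (rule norm_cauchy_schwarz)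
      finally have "norm t * norm t \<le> norm t * norm (r - \<delta> *\<^sub>R u)"
        by (metis power2_norm_eq_inner power2_eq_square)
      then show ?thesis
        unfolding t_def[symmetric] by (cases "t = 0") auto
    qed
    also have "\<dots> \<le> norm r + \<delta> * norm u"
      using norm_triangle_ineq4[of r "\<delta> *\<^sub>R u"] \<delta> by simp
    also have "\<dots> \<le> norm r + \<delta> * C" using uC \<delta> by (intro add_left_mono mult_left_mono)
    finally show "norm dx \<le> C \<and> norm dz \<le> C \<and> norm (r - \<delta> *\<^sub>R dy) \<le> norm r + \<delta> * C"
      using dxC0 C_ge dzC by linarith
  qed
qed


section \<open>Infeasibilities along a step\<close>

text \<open>Here \<open>u\<close> is the residual now and \<open>v\<close> the one after a full
  step. Up to perturbations, the residual shrinks by \<open>1 - \<alpha> * \<tau>\<close> and the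
  gap at most by \<open>1 - \<alpha> * (1 - \<beta>)\<close>, with
  \<open>1 - \<beta> < \<tau>\<close>. The margin is at least
  \<open>\<alpha> * e * (\<beta> + \<tau> - 1)\<close>: one half pays for \<open>D\<close>, the
  other for the second-order term \<open>\<alpha>\<^sup>2 * S\<close>. A residual within tolerance
  stays there because \<open>D \<le> \<tau> * \<epsilon>'\<close>.\<close>

lemma residual_step:
  fixes u v :: "'v::real_normed_vector"
  assumes \<alpha>: "0 \<le> \<alpha>" "\<alpha> \<le> 1"
    and u: "\<kappa> * norm u \<le> G \<or> norm u \<le> \<epsilon>'"
    and v: "norm v \<le> (1 - \<tau>) * norm u + D"
    and pos: "0 < \<kappa>" "0 < \<tau>" "\<tau> \<le> 1" "0 < \<epsilon>'"
    and D: "D \<le> \<tau> * \<epsilon>'" "\<kappa> * D \<le> e * (\<beta> + \<tau> - 1) / 2"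
    and S: "\<alpha> * S \<le> e * (\<beta> + \<tau> - 1) / 2" and e: "e \<le> G" "0 < \<beta> + \<tau> - 1"
    and G': "G * (1 - \<alpha> * (1 - \<beta>)) - \<alpha>\<^sup>2 * S \<le> G'"
  shows "\<kappa> * norm ((1 - \<alpha>) *\<^sub>R u + \<alpha> *\<^sub>R v) \<le> G' \<or> norm ((1 - \<alpha>) *\<^sub>R u + \<alpha> *\<^sub>R v) \<le> \<epsilon>'"
proof -
  have "norm ((1 - \<alpha>) *\<^sub>R u + \<alpha> *\<^sub>R v) \<le> (1 - \<alpha>) * norm u + \<alpha> * norm v"
    using \<alpha> norm_triangle_ineq[of "(1 - \<alpha>) *\<^sub>R u" "\<alpha> *\<^sub>R v"] by simp
  also have "\<dots> \<le> (1 - \<alpha>) * norm u + \<alpha> * ((1 - \<tau>) * norm u + D)"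
    using v \<alpha> by (intro add_left_mono mult_left_mono)
  also have "\<dots> = (1 - \<alpha> * \<tau>) * norm u + \<alpha> * D" by (simp add: algebra_simps)
  finally have le: "norm ((1 - \<alpha>) *\<^sub>R u + \<alpha> *\<^sub>R v) \<le> (1 - \<alpha> * \<tau>) * norm u + \<alpha> * D" .
  have \<alpha>\<tau>: "0 \<le> 1 - \<alpha> * \<tau>" using \<alpha> pos by (simp add: mult_le_one)
  from u show ?thesis
  proof
    assume "norm u \<le> \<epsilon>'"
    then have "(1 - \<alpha> * \<tau>) * norm u + \<alpha> * D \<le> (1 - \<alpha> * \<tau>) * \<epsilon>' + \<alpha> * (\<tau> * \<epsilon>')"
      using \<alpha>\<tau> \<alpha> D by (intro add_mono mult_left_mono)
    then show ?thesis using le by (simp add: algebra_simps)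
  next
    assume *: "\<kappa> * norm u \<le> G"
    have "\<kappa> * norm ((1 - \<alpha>) *\<^sub>R u + \<alpha> *\<^sub>R v) \<le> \<kappa> * ((1 - \<alpha> * \<tau>) * norm u + \<alpha> * D)"
      using le pos by (intro mult_left_mono) auto
    also have "\<dots> = (1 - \<alpha> * \<tau>) * (\<kappa> * norm u) + \<alpha> * (\<kappa> * D)" by (simp add: algebra_simps)
    also have "\<dots> \<le> (1 - \<alpha> * \<tau>) * G + \<alpha> * (e * (\<beta> + \<tau> - 1) / 2)"
      using * \<alpha>\<tau> \<alpha> D by (intro add_mono mult_left_mono)
    also have "\<dots> \<le> (1 - \<alpha> * \<tau>) * G + \<alpha> * (e * (\<beta> + \<tau> - 1)) - \<alpha> * (\<alpha> * S)"
      using mult_left_mono[OF S \<alpha>(1)] by simp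
    also have "\<dots> \<le> (1 - \<alpha> * \<tau>) * G + \<alpha> * (G * (\<beta> + \<tau> - 1)) - \<alpha> * (\<alpha> * S)"
      using e \<alpha> by (intro diff_right_mono add_left_mono mult_left_mono mult_right_mono) auto
    also have "\<dots> = G * (1 - \<alpha> * (1 - \<beta>)) - \<alpha>\<^sup>2 * S" by (simp add: algebra_simps power2_eq_square)
    finally show ?thesis using G' by linarith
  qed
qed

section \<open>The step to the boundary\<close>

lemma closed_nonneg_ray: "closed {\<alpha>. nonneg_vec (v + \<alpha> *\<^sub>R dv)}"
  unfolding nonneg_vec_def
  by (intro closed_Collect_all closed_Collect_le continuous_intros)

lemma max_step_ge:
  assumes "nonneg_vec (v + a *\<^sub>R dv)"
  shows "ereal a \<le> max_step v dv"
proof (cases "bdd_above {\<alpha>. nonneg_vec (v + \<alpha> *\<^sub>R dv)}")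
  case True
  let ?S = "{\<alpha>. nonneg_vec (v + \<alpha> *\<^sub>R dv)}"
  \<comment> \<open>The feasible set of steps is closed, so the supremum is attained and is what
    \<open>GREATEST\<close> denotes.\<close>
  have "Sup ?S \<in> ?S"
    using assms by (intro closed_contains_Sup True closed_nonneg_ray) auto
  then have "(GREATEST \<alpha>. \<alpha> \<in> ?S) = Sup ?S"
    using True by (intro Greatest_equality) (auto intro: cSup_upper)
  moreover have "a \<le> Sup ?S" using assms True by (intro cSup_upper) auto
  ultimately show ?thesis
    using True by (simp add: max_step_def max_or_infinity_def)
qed (simp add: max_step_def max_or_infinity_def)

text \<open>A component that is positive at 0 and zero at \<open>a > 0\<close> has negative slope,
  hence is negative beyond \<open>a\<close>.\<close>

lemma max_step_eq:
  assumes pos: "pos_vec v" and a: "0 < a" and nonneg: "nonneg_vec (v + a *\<^sub>R dv)"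
    and zero: "(v + a *\<^sub>R dv) $ i = 0"
  shows "max_step v dv = ereal a"
proof -
  have le: "\<alpha> \<le> a" if "nonneg_vec (v + \<alpha> *\<^sub>R dv)" for \<alpha>
  proof -
    have vi: "v $ i = - (a * dv $ i)" "0 < v $ i" using zero pos by (auto simp: pos_vec_def)
    then have "dv $ i < 0" using a by (simp add: mult_less_0_iff)
    moreover have "a * dv $ i \<le> \<alpha> * dv $ i"
      using that[unfolded nonneg_vec_def, rule_format, of i] vi by simp
    ultimately show ?thesis by simp
  qed
  then have bdd: "bdd_above {\<alpha>. nonneg_vec (v + \<alpha> *\<^sub>R dv)}" by (auto simp: bdd_above_def)
  moreover have "(GREATEST \<alpha>. \<alpha> \<in> {\<alpha>. nonneg_vec (v + \<alpha> *\<^sub>R dv)}) = a"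
    using nonneg le by (intro Greatest_equality) auto
  ultimately show ?thesis by (simp add: max_step_def max_or_infinity_def)
qed

section \<open>Short steps are admissible\<close>

context ipm
begin

text \<open>One of the three tests for a solution fails. If it is a feasibility test, membership in
  the neighborhood forces the gap to dominate the infeasibility, which exceeds its
  tolerance.\<close>

lemma gap_lower_bound:
  assumes "w \<in> neighborhood" and not_solution: "\<not> is_solution w" and "0 < \<gamma>\<^sub>p" "0 < \<gamma>\<^sub>d"
  shows "min \<epsilon> (min (\<gamma>\<^sub>p * \<epsilon>\<^sub>p) (\<gamma>\<^sub>d * \<epsilon>\<^sub>d)) \<le> gap w"
proof (cases w)
  case (fields x y z)
  have nonneg: "nonneg_vec x" "nonneg_vec z"
    using assms(1) by (auto simp: fields neighborhood_def pos_vec_def nonneg_vec_def less_imp_le)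
  from not_solution consider "x \<bullet> z > \<epsilon>" | "norm (A *v x - b) > \<epsilon>\<^sub>p"
    | "norm (transpose A *v y + z - c) > \<epsilon>\<^sub>d"
    using nonneg by (fastforce simp: fields is_solution_def)
  then show ?thesis
  proof cases
    case 1
    then show ?thesis by (simp add: fields)
  next
    case 2
    then have "\<gamma>\<^sub>p * \<epsilon>\<^sub>p \<le> \<gamma>\<^sub>p * norm (A *v x - b)" using assms by simp
    moreover have "\<dots> \<le> x \<bullet> z" using assms(1) 2 by (auto simp: fields neighborhood_def)
    ultimately show ?thesis by (simp add: fields)
  next
    case 3
    then have "\<gamma>\<^sub>d * \<epsilon>\<^sub>d \<le> \<gamma>\<^sub>d * norm (transpose A *v y + z - c)" using assms by simp
    moreover have "\<dots> \<le> x \<bullet> z" using assms(1) 3 by (auto simp: fields neighborhood_def)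
    ultimately show ?thesis by (simp add: fields)
  qed
qed

text \<open>This is the condition under the quantifier of \<open>alpha_bar\<close>, so that
  \<open>alpha_bar w d\<close> is meant to be the end of the longest initial interval of admissible
  steps.\<close>

definition admissible_step :: "('n, 'm) point \<Rightarrow> ('n, 'm) point \<Rightarrow> real \<Rightarrow> bool" where
  "admissible_step w d \<alpha> \<longleftrightarrow> w + \<alpha> *\<^sub>R d \<in> neighborhood \<and>
     gap (w + \<alpha> *\<^sub>R d) \<le> (1 - \<alpha> * (1 - \<beta>\<^sub>2)) * gap w"

text \<open>Along the step, the gap and the products \<open>x $ i * z $ i\<close> are affine in
  \<alpha> up to an error of at most \<open>\<alpha>\<^sup>2 * C\<^sup>2\<close>. Each condition
  holds to first order with a margin of \<alpha> times a positive constant, and the bounds on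
  \<open>\<alpha> * C\<^sup>2\<close> let that margin absorb the error. \<open>D\<^sub>1\<close> and
  \<open>D\<^sub>2\<close> are the perturbations due to regularization.\<close>

lemma admissible_step_if_small:
  fixes x dx z dz :: "real ^ 'n" and y dy :: "real ^ 'm"
  defines "n \<equiv> real CARD('n)"
  assumes nb: "(x, y, z) \<in> neighborhood"
    and e: "0 < e" "e \<le> x \<bullet> z"
    and \<eta>: "0 < \<eta>" "\<And>i. \<eta> \<le> x $ i" "\<And>i. \<eta> \<le> z $ i"
    and par: "0 < \<epsilon>\<^sub>p" "0 < \<epsilon>\<^sub>d" "0 < \<gamma>" "\<gamma> < 1" "0 < \<gamma>\<^sub>p" "0 < \<gamma>\<^sub>d" "0 < \<beta>\<^sub>1"
      "0 < \<tau>\<^sub>1" "\<tau>\<^sub>1 \<le> 1" "0 < \<tau>\<^sub>2" "\<tau>\<^sub>2 \<le> 1" "0 < \<beta>\<^sub>1 + \<tau>\<^sub>1 - 1" "0 < \<beta>\<^sub>1 + \<tau>\<^sub>2 - 1"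
    and C: "0 < C" "norm dx \<le> C" "norm dz \<le> C"
    and newton: "\<And>i. z $ i * dx $ i + x $ i * dz $ i = \<beta>\<^sub>1 * (x \<bullet> z / n) - x $ i * z $ i"
    and primal: "norm (A *v (x + dx) - b) \<le> (1 - \<tau>\<^sub>1) * norm (A *v x - b) + D\<^sub>1"
    and dual: "norm (transpose A *v (y + dy) + (z + dz) - c)
        \<le> (1 - \<tau>\<^sub>2) * norm (transpose A *v y + z - c) + D\<^sub>2"
    and D1: "D\<^sub>1 \<le> \<tau>\<^sub>1 * \<epsilon>\<^sub>p" "\<gamma>\<^sub>p * D\<^sub>1 \<le> e * (\<beta>\<^sub>1 + \<tau>\<^sub>1 - 1) / 2"
    and D2: "D\<^sub>2 \<le> \<tau>\<^sub>2 * \<epsilon>\<^sub>d" "\<gamma>\<^sub>d * D\<^sub>2 \<le> e * (\<beta>\<^sub>1 + \<tau>\<^sub>2 - 1) / 2"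
    and \<alpha>: "0 \<le> \<alpha>" "\<alpha> \<le> 1" "\<alpha> * C \<le> \<eta> / 2" "\<alpha> * C\<^sup>2 \<le> e * (\<beta>\<^sub>2 - \<beta>\<^sub>1)"
      "\<alpha> * C\<^sup>2 \<le> (1 - \<gamma>) * \<beta>\<^sub>1 * (e / n) / 2"
      "\<alpha> * C\<^sup>2 \<le> e * (\<beta>\<^sub>1 + \<tau>\<^sub>1 - 1) / 2" "\<alpha> * C\<^sup>2 \<le> e * (\<beta>\<^sub>1 + \<tau>\<^sub>2 - 1) / 2"
  shows "admissible_step (x, y, z) (dx, dy, dz) \<alpha>"
proof -
  define G where "G = x \<bullet> z"
  define G' where "G' = (x + \<alpha> *\<^sub>R dx) \<bullet> (z + \<alpha> *\<^sub>R dz)"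
  have n: "1 \<le> n" unfolding n_def by (simp add: Suc_le_eq)
  have e_G: "e \<le> G" using e by (simp add: G_def)
  have linear_terms: "z \<bullet> dx + x \<bullet> dz = \<beta>\<^sub>1 * G - G"
  proof -
    have "z \<bullet> dx + x \<bullet> dz = (\<Sum>i\<in>UNIV. \<beta>\<^sub>1 * (x \<bullet> z / n) - x $ i * z $ i)"
      by (simp only: inner_vec_sum[of z] inner_vec_sum[of x dz] sum.distrib[symmetric] newton)
    also have "\<dots> = n * (\<beta>\<^sub>1 * (G / n)) - G"
      by (simp add: sum_subtractf n_def G_def inner_vec_sum[of x z])
    finally show ?thesis using n by simp
  qed
  have G'_eq: "G' = G * (1 - \<alpha> * (1 - \<beta>\<^sub>1)) + \<alpha>\<^sup>2 * (dx \<bullet> dz)"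
  proof -
    have "G' = G + \<alpha> * (z \<bullet> dx + x \<bullet> dz) + \<alpha>\<^sup>2 * (dx \<bullet> dz)"
      by (simp add: G'_def G_def inner_add_left inner_add_right inner_commute
          algebra_simps power2_eq_square)
    then show ?thesis unfolding linear_terms by (simp add: algebra_simps)
  qed
  have "\<bar>dx \<bullet> dz\<bar> \<le> norm dx * norm dz" by (rule Cauchy_Schwarz_ineq2)
  also have "\<dots> \<le> C * C" using C by (intro mult_mono) auto
  finally have dxdz: "\<bar>dx \<bullet> dz\<bar> \<le> C\<^sup>2" by (simp add: power2_eq_square)
  have comp: "\<bar>dx $ i\<bar> \<le> C" "\<bar>dz $ i\<bar> \<le> C" for i
    using component_le_norm_cart[of dx i] component_le_norm_cart[of dz i] C by linarith+
  have dxdz_i: "\<bar>dx $ i * dz $ i\<bar> \<le> C\<^sup>2" for i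
    unfolding abs_mult power2_eq_square using comp[of i] C by (intro mult_mono) auto
  have quad: "\<bar>\<alpha>\<^sup>2 * (dx \<bullet> dz)\<bar> \<le> \<alpha>\<^sup>2 * C\<^sup>2" "\<bar>\<alpha>\<^sup>2 * (dx $ i * dz $ i)\<bar> \<le> \<alpha>\<^sup>2 * C\<^sup>2" for i
    using dxdz dxdz_i[of i] by (simp_all add: abs_mult mult_left_mono)
  have small: "\<alpha>\<^sup>2 * C\<^sup>2 \<le> \<alpha> * t" if "\<alpha> * C\<^sup>2 \<le> t" for t
    using mult_left_mono[OF that \<alpha>(1)] by (simp add: power2_eq_square mult.assoc)
  have G'_ge: "G * (1 - \<alpha> * (1 - \<beta>\<^sub>1)) - \<alpha>\<^sup>2 * C\<^sup>2 \<le> G'"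
    and G'_le: "G' \<le> G * (1 - \<alpha> * (1 - \<beta>\<^sub>1)) + \<alpha>\<^sup>2 * C\<^sup>2"
    using quad(1) unfolding G'_eq by linarith+
  have "e * (\<beta>\<^sub>2 - \<beta>\<^sub>1) \<le> G * (\<beta>\<^sub>2 - \<beta>\<^sub>1)"
  proof (rule mult_right_mono[OF e_G])
    \<comment> \<open>The sign of \<open>\<beta>\<^sub>2 - \<beta>\<^sub>1\<close> is read off from
      the smallness condition on \<alpha>, whose left side is nonnegative.\<close>
    have "0 \<le> e * (\<beta>\<^sub>2 - \<beta>\<^sub>1)"
      using \<alpha>(1,4) by (meson mult_nonneg_nonneg order_trans zero_le_power2)
    then show "0 \<le> \<beta>\<^sub>2 - \<beta>\<^sub>1" using e by (simp add: zero_le_mult_iff)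
  qed
  then have "\<alpha>\<^sup>2 * C\<^sup>2 \<le> \<alpha> * (G * (\<beta>\<^sub>2 - \<beta>\<^sub>1))"
    using small[OF \<alpha>(4)] \<alpha>(1) by (meson mult_left_mono order_trans)
  then have decrease: "G' \<le> (1 - \<alpha> * (1 - \<beta>\<^sub>2)) * G"
    using G'_le by (simp add: algebra_simps)
  have pos_add: "0 < p + \<alpha> * q" if "\<eta> \<le> p" "\<bar>q\<bar> \<le> C" for p q
  proof -
    have "\<bar>\<alpha> * q\<bar> \<le> \<alpha> * C" using that \<alpha> by (simp add: abs_mult mult_left_mono)
    then show ?thesis using that \<alpha>(3) \<eta>(1) by linarith
  qed
  have pos: "pos_vec (x + \<alpha> *\<^sub>R dx)" "pos_vec (z + \<alpha> *\<^sub>R dz)"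
    using \<eta> comp by (auto simp: pos_vec_def intro!: pos_add)
  \<comment> \<open>The first-order margin is
    \<open>\<alpha> * (1 - \<gamma>) * \<beta>\<^sub>1 * (G / n)\<close>. It pays for two errors,
    one from \<open>G'\<close> and one from the product of components, which explains the division
    by 2 in the bound on \<alpha>.\<close>
  have central: "\<gamma> * G' / n \<le> (x + \<alpha> *\<^sub>R dx) $ i * (z + \<alpha> *\<^sub>R dz) $ i" for i
  proof -
    have "\<gamma> * G' / n \<le> \<gamma> * (G * (1 - \<alpha> * (1 - \<beta>\<^sub>1)) + \<alpha>\<^sup>2 * C\<^sup>2) / n"
      using G'_le par n by (intro divide_right_mono mult_left_mono) auto
    also have "\<dots> = (1 - \<alpha>) * (\<gamma> * G / n) + \<alpha> * (\<gamma> * \<beta>\<^sub>1 * (G / n)) + (\<gamma> / n) * (\<alpha>\<^sup>2 * C\<^sup>2)"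
      using n by (simp add: field_simps)
    also have "\<dots> \<le> (1 - \<alpha>) * (\<gamma> * G / n) + \<alpha> * (\<gamma> * \<beta>\<^sub>1 * (G / n)) + \<alpha>\<^sup>2 * C\<^sup>2"
      using par n by (intro add_left_mono mult_left_le_one_le) (auto simp: field_simps)
    also have "\<dots> \<le> (1 - \<alpha>) * (\<gamma> * G / n) + \<alpha> * (\<beta>\<^sub>1 * (G / n)) - \<alpha>\<^sup>2 * C\<^sup>2"
    proof -
      have "e / n \<le> G / n" using e_G n by (simp add: divide_right_mono)
      then have "(1 - \<gamma>) * \<beta>\<^sub>1 * (e / n) / 2 \<le> (1 - \<gamma>) * \<beta>\<^sub>1 * (G / n) / 2"
        using par e_G n by (intro divide_right_mono mult_left_mono) auto
      then have "\<alpha>\<^sup>2 * C\<^sup>2 \<le> \<alpha> * ((1 - \<gamma>) * \<beta>\<^sub>1 * (G / n) / 2)"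
        using small \<alpha>(5) by (meson order_trans)
      then show ?thesis by (simp add: algebra_simps)
    qed
    also have "\<dots> \<le> (1 - \<alpha>) * (x $ i * z $ i) + \<alpha> * (\<beta>\<^sub>1 * (G / n)) - \<alpha>\<^sup>2 * C\<^sup>2"
      using nb \<alpha> by (intro diff_right_mono add_right_mono mult_left_mono)
        (auto simp: neighborhood_def G_def n_def)
    also have "\<dots> \<le> (1 - \<alpha>) * (x $ i * z $ i) + \<alpha> * (\<beta>\<^sub>1 * (G / n)) + \<alpha>\<^sup>2 * (dx $ i * dz $ i)"
      using quad(2)[of i] by linarith
    also have "\<dots> = x $ i * z $ i + \<alpha> * (z $ i * dx $ i + x $ i * dz $ i) + \<alpha>\<^sup>2 * (dx $ i * dz $ i)"
      unfolding newton[of i] G_def by (simp add: algebra_simps)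
    also have "\<dots> = (x + \<alpha> *\<^sub>R dx) $ i * (z + \<alpha> *\<^sub>R dz) $ i"
      by (simp add: algebra_simps power2_eq_square)
    finally show ?thesis .
  qed
  \<comment> \<open>Residuals are affine in the step, so they interpolate between their values now
    and after a full step.\<close>
  have primal_eq: "A *v (x + \<alpha> *\<^sub>R dx) - b
      = (1 - \<alpha>) *\<^sub>R (A *v x - b) + \<alpha> *\<^sub>R (A *v (x + dx) - b)"
    by (simp add: matrix_vector_right_distrib matrix_vector_mult_scaleR algebra_simps)
  have dual_eq: "transpose A *v (y + \<alpha> *\<^sub>R dy) + (z + \<alpha> *\<^sub>R dz) - c
      = (1 - \<alpha>) *\<^sub>R (transpose A *v y + z - c) + \<alpha> *\<^sub>R (transpose A *v (y + dy) + (z + dz) - c)"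
    by (simp add: matrix_vector_right_distrib matrix_vector_mult_scaleR algebra_simps
        del: transpose_matrix_vector)
  have "\<gamma>\<^sub>p * norm (A *v (x + \<alpha> *\<^sub>R dx) - b) \<le> G' \<or> norm (A *v (x + \<alpha> *\<^sub>R dx) - b) \<le> \<epsilon>\<^sub>p"
    unfolding primal_eq
    by (rule residual_step[OF \<alpha>(1,2) _ primal _ _ _ _ D1 \<alpha>(6) e_G _ G'_ge])
       (use nb par in \<open>auto simp: neighborhood_def G_def\<close>)
  moreover have "\<gamma>\<^sub>d * norm (transpose A *v (y + \<alpha> *\<^sub>R dy) + (z + \<alpha> *\<^sub>R dz) - c) \<le> G' \<or>
      norm (transpose A *v (y + \<alpha> *\<^sub>R dy) + (z + \<alpha> *\<^sub>R dz) - c) \<le> \<epsilon>\<^sub>d"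
    unfolding dual_eq
    by (rule residual_step[OF \<alpha>(1,2) _ dual _ _ _ _ D2 \<alpha>(7) e_G _ G'_ge])
       (use nb par in \<open>auto simp: neighborhood_def G_def\<close>)
  ultimately show ?thesis
    using pos central decrease
    by (auto simp: admissible_step_def neighborhood_def G'_def G_def n_def)
qed


section \<open>Attainment of the step-length of step 5\<close>

lemma admissible_step_0: "w \<in> neighborhood \<Longrightarrow> admissible_step w d 0"
  by (cases w; cases d) (simp add: admissible_step_def)

text \<open>All conditions except strict positivity survive the limit. If a component vanished at
  \<open>a\<close>, centrality would make the gap nonpositive, hence both residuals would be within
  tolerance. Then \<open>a\<close> would be the step to the boundary and lead to a solution, so step
  4 would have stopped.\<close>

lemma admissible_step_closure:
  assumes w: "w \<in> neighborhood" and par: "0 < \<epsilon>" "0 < \<epsilon>\<^sub>p" "0 < \<epsilon>\<^sub>d" "0 < \<gamma>" "0 < \<gamma>\<^sub>p" "0 < \<gamma>\<^sub>d"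
    and a: "0 < a" and below: "\<And>\<alpha>. 0 \<le> \<alpha> \<Longrightarrow> \<alpha> < a \<Longrightarrow> admissible_step w d \<alpha>"
    and no_stop: "\<not> stops_at_step4 w d"
  shows "admissible_step w d a"
proof -
  obtain x y z where wf: "w = (x, y, z)" by (cases w)
  obtain dx dy dz where df: "d = (dx, dy, dz)" by (cases d)
  \<comment> \<open>Admissibility with positivity weakened to nonnegativity, which is a closed
    condition on \<alpha>.\<close>
  define K where "K = {\<alpha>. (\<forall>i. 0 \<le> x $ i + \<alpha> * dx $ i) \<and> (\<forall>i. 0 \<le> z $ i + \<alpha> * dz $ i) \<and>
     (\<forall>i. \<gamma> * ((x + \<alpha> *\<^sub>R dx) \<bullet> (z + \<alpha> *\<^sub>R dz)) / real CARD('n)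
        \<le> (x $ i + \<alpha> * dx $ i) * (z $ i + \<alpha> * dz $ i)) \<and>
     (\<gamma>\<^sub>p * norm (A *v (x + \<alpha> *\<^sub>R dx) - b) \<le> (x + \<alpha> *\<^sub>R dx) \<bullet> (z + \<alpha> *\<^sub>R dz) \<or>
       norm (A *v (x + \<alpha> *\<^sub>R dx) - b) \<le> \<epsilon>\<^sub>p) \<and>
     (\<gamma>\<^sub>d * norm (transpose A *v (y + \<alpha> *\<^sub>R dy) + (z + \<alpha> *\<^sub>R dz) - c)
          \<le> (x + \<alpha> *\<^sub>R dx) \<bullet> (z + \<alpha> *\<^sub>R dz) \<or>
       norm (transpose A *v (y + \<alpha> *\<^sub>R dy) + (z + \<alpha> *\<^sub>R dz) - c) \<le> \<epsilon>\<^sub>d) \<and>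
     (x + \<alpha> *\<^sub>R dx) \<bullet> (z + \<alpha> *\<^sub>R dz) \<le> (1 - \<alpha> * (1 - \<beta>\<^sub>2)) * (x \<bullet> z)}"
  have "closed K"
    unfolding K_def matrix_vector_right_distrib matrix_vector_mult_scaleR
    by (intro closed_Collect_conj closed_Collect_disj closed_Collect_all closed_Collect_le
        continuous_intros) auto
  moreover have "{0..<a} \<subseteq> K"
  proof
    fix \<alpha> assume "\<alpha> \<in> {0..<a}"
    then have "admissible_step w d \<alpha>" using below by auto
    then show "\<alpha> \<in> K"
      by (auto simp: K_def wf df admissible_step_def neighborhood_def pos_vec_def less_imp_le)
  qed
  ultimately have "closure {0..<a} \<subseteq> K" by (rule closure_minimal[rotated])
  then have aK: "a \<in> K" using a by auto
  have nonneg: "nonneg_vec (x + a *\<^sub>R dx)" "nonneg_vec (z + a *\<^sub>R dz)"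
    using aK by (auto simp: K_def nonneg_vec_def)
  have "pos_vec (x + a *\<^sub>R dx) \<and> pos_vec (z + a *\<^sub>R dz)"
  proof (rule ccontr)
    assume "\<not> ?thesis"
    have central: "\<gamma> * ((x + a *\<^sub>R dx) \<bullet> (z + a *\<^sub>R dz)) / real CARD('n)
        \<le> (x + a *\<^sub>R dx) $ i * (z + a *\<^sub>R dz) $ i" for i
      using aK by (simp add: K_def)
    from \<open>\<not> (pos_vec (x + a *\<^sub>R dx) \<and> pos_vec (z + a *\<^sub>R dz))\<close>
    obtain i where i: "(x + a *\<^sub>R dx) $ i = 0 \<or> (z + a *\<^sub>R dz) $ i = 0"
      using nonneg by (auto simp: pos_vec_def nonneg_vec_def not_less intro: antisym)
    then have "\<gamma> * ((x + a *\<^sub>R dx) \<bullet> (z + a *\<^sub>R dz)) / real CARD('n) \<le> 0"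
      using central[of i] by auto
    then have gap0: "(x + a *\<^sub>R dx) \<bullet> (z + a *\<^sub>R dz) \<le> 0"
      using par by (simp add: divide_le_0_iff mult_le_0_iff)
    have "norm (A *v (x + a *\<^sub>R dx) - b) \<le> \<epsilon>\<^sub>p"
      "norm (transpose A *v (y + a *\<^sub>R dy) + (z + a *\<^sub>R dz) - c) \<le> \<epsilon>\<^sub>d"
    proof -
      have *: "t \<le> t'" if "k * t \<le> G \<or> t \<le> t'" "G \<le> 0" "0 < k" "0 < t'" for k t t' G :: real
      proof -
        have "t \<le> 0" if "k * t \<le> G" using that \<open>G \<le> 0\<close> \<open>0 < k\<close>
          by (meson mult_le_0_iff not_le order_trans)
        then show ?thesis using that by linarith
      qed
      show "norm (A *v (x + a *\<^sub>R dx) - b) \<le> \<epsilon>\<^sub>p"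
        by (rule *[OF _ gap0 \<open>0 < \<gamma>\<^sub>p\<close> \<open>0 < \<epsilon>\<^sub>p\<close>]) (use aK in \<open>auto simp: K_def\<close>)
      show "norm (transpose A *v (y + a *\<^sub>R dy) + (z + a *\<^sub>R dz) - c) \<le> \<epsilon>\<^sub>d"
        by (rule *[OF _ gap0 \<open>0 < \<gamma>\<^sub>d\<close> \<open>0 < \<epsilon>\<^sub>d\<close>]) (use aK in \<open>auto simp: K_def\<close>)
    qed
    then have sol: "is_solution (w + a *\<^sub>R d)"
      using nonneg gap0 par by (simp add: wf df is_solution_def)
    have wpos: "pos_vec x" "pos_vec z" using w by (auto simp: wf neighborhood_def)
    \<comment> \<open>The block with the vanishing component has maximal step exactly
      \<open>a\<close>; the other is nonnegative at \<open>a\<close>, so its maximal step is no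
      smaller.\<close>
    have "max_step x dx = ereal a \<or> max_step z dz = ereal a"
      using i max_step_eq[OF wpos(1) a nonneg(1)] max_step_eq[OF wpos(2) a nonneg(2)] by blast
    then have "alpha_star w d = ereal a"
      using max_step_ge[OF nonneg(1)] max_step_ge[OF nonneg(2)]
      by (auto simp: wf df min_def)
    with sol no_stop show False by (auto simp: stops_at_step4_def)
  qed
  then show ?thesis
    using aK by (auto simp: wf df K_def admissible_step_def neighborhood_def)
qed

text \<open>Steps below the supremum of \<open>T\<close> are admissible, and closure adds the
  supremum itself. So \<open>GREATEST\<close> denotes a true maximum, and any initial interval of
  admissible steps bounds \<open>alpha_bar\<close> from below.\<close>

lemma alpha_bar_greatest:
  assumes w: "w \<in> neighborhood" and par: "0 < \<epsilon>" "0 < \<epsilon>\<^sub>p" "0 < \<epsilon>\<^sub>d" "0 < \<gamma>" "0 < \<gamma>\<^sub>p" "0 < \<gamma>\<^sub>d"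
    and no_stop: "\<not> stops_at_step4 w d"
  shows "0 \<le> alpha_bar w d" "alpha_bar w d \<le> 1" "admissible_step w d (alpha_bar w d)"
    and "\<And>a. \<lbrakk>0 \<le> a; a \<le> 1; \<And>\<alpha>. 0 \<le> \<alpha> \<Longrightarrow> \<alpha> \<le> a \<Longrightarrow> admissible_step w d \<alpha>\<rbrakk> \<Longrightarrow> a \<le> alpha_bar w d"
proof -
  define T where "T = {a \<in> {0..1}. \<forall>\<alpha>\<in>{0..a}. admissible_step w d \<alpha>}"
  have mem_T: "t \<in> T \<longleftrightarrow> 0 \<le> t \<and> t \<le> 1 \<and> (\<forall>\<alpha>. 0 \<le> \<alpha> \<and> \<alpha> \<le> t \<longrightarrow> admissible_step w d \<alpha>)" for t
    by (auto simp: T_def)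
  have T0: "0 \<in> T" using admissible_step_0[OF w, of d] by (simp add: T_def)
  have bdd: "bdd_above T" by (rule bdd_aboveI[of _ 1]) (simp add: T_def)
  have Sup01: "0 \<le> Sup T" "Sup T \<le> 1"
    using T0 bdd by (auto simp: T_def intro!: cSup_upper cSup_least)
  have below: "admissible_step w d \<alpha>" if \<alpha>: "0 \<le> \<alpha>" "\<alpha> < Sup T" for \<alpha>
  proof -
    obtain t where "t \<in> T" "\<alpha> < t" using \<alpha>(2) T0 bdd less_cSup_iff[of T \<alpha>] by auto
    then show ?thesis using \<alpha>(1) by (auto simp: T_def)
  qed
  have "admissible_step w d (Sup T)"
  proof (cases "Sup T = 0")
    case True
    then show ?thesis using admissible_step_0[OF w, of d] by simp
  next
    case False
    then show ?thesis using Sup01 admissible_step_closure[OF w par _ below no_stop] by auto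
  qed
  then have SupT: "Sup T \<in> T"
    unfolding mem_T using Sup01 below by (metis order_le_less)
  have "alpha_bar w d = (GREATEST a. a \<in> T)"
    by (simp add: alpha_bar_def T_def admissible_step_def Ball_def)
  also have "\<dots> = Sup T"
    using SupT bdd by (intro Greatest_equality) (auto intro: cSup_upper)
  finally have eq: "alpha_bar w d = Sup T" .
  then show "0 \<le> alpha_bar w d" "alpha_bar w d \<le> 1" "admissible_step w d (alpha_bar w d)"
    using SupT unfolding mem_T by auto
  show "a \<le> alpha_bar w d"
    if "0 \<le> a" "a \<le> 1" "\<And>\<alpha>. 0 \<le> \<alpha> \<Longrightarrow> \<alpha> \<le> a \<Longrightarrow> admissible_step w d \<alpha>" for a
    unfolding eq using that bdd by (intro cSup_upper) (auto simp: mem_T)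
qed

section \<open>Existence of admissible choices\<close>

lemma gap_pos: "w \<in> neighborhood \<Longrightarrow> 0 < gap w"
  by (cases w) (auto simp: neighborhood_def pos_vec_def inner_vec_sum intro!: sum_pos)

text \<open>Taking \<open>alpha_bar\<close> for both step-lengths works: the decrease guaranteed
  with \<open>\<beta>\<^sub>2\<close> is at least the one demanded with
  \<open>\<beta>\<^sub>3\<close>.\<close>

lemma next_iterate_exists:
  assumes w: "w \<in> neighborhood" and par: "0 < \<epsilon>" "0 < \<epsilon>\<^sub>p" "0 < \<epsilon>\<^sub>d" "0 < \<gamma>" "0 < \<gamma>\<^sub>p" "0 < \<gamma>\<^sub>d"
    and \<beta>: "\<beta>\<^sub>2 \<le> \<beta>\<^sub>3" and no_stop: "\<not> stops_at_step4 w d"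
  shows "\<exists>w'. next_iterate w d w'"
proof -
  note ab = alpha_bar_greatest[OF w par no_stop]
  let ?a = "alpha_bar w d"
  have "?a * (1 - \<beta>\<^sub>3) \<le> ?a * (1 - \<beta>\<^sub>2)" using ab(1) \<beta> by (intro mult_left_mono) auto
  then have "(1 - ?a * (1 - \<beta>\<^sub>2)) * gap w \<le> (1 - ?a * (1 - \<beta>\<^sub>3)) * gap w"
    using gap_pos[OF w] by (intro mult_right_mono) auto
  then have gap': "gap (w + ?a *\<^sub>R d) \<le> (1 - ?a * (1 - \<beta>\<^sub>3)) * gap w"
    using ab(3) by (simp add: admissible_step_def)
  have nb: "w + ?a *\<^sub>R d \<in> neighborhood" using ab(3) by (simp add: admissible_step_def)
  obtain x y z dx dy dz where eq: "w = (x, y, z)" "d = (dx, dy, dz)" by (cases w; cases d)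
  have "next_iterate w d (w + ?a *\<^sub>R d)"
    using nb gap' ab(1,2) unfolding eq next_iterate_def by auto
  then show ?thesis ..
qed

text \<open>The exact system is solvable by block elimination of \<open>dz\<close> and then
  \<open>dx\<close>. The Schur complement \<open>S\<close> for \<open>dy\<close> is positive
  definite thanks to the term in \<delta>, whatever the rank of \<open>A\<close>.\<close>

lemma search_direction_exists:
  assumes w: "w \<in> neighborhood" and par: "0 < \<rho>" "0 < \<delta>" "\<tau>\<^sub>1 \<le> 1" "\<tau>\<^sub>2 \<le> 1"
  shows "\<exists>d. search_direction w d"
proof -
  obtain x y z where wf: "w = (x, y, z)" by (cases w)
  have pos: "0 < x $ i" "0 < z $ i" for i using w by (auto simp: wf neighborhood_def pos_vec_def)
  define f where "f = c - transpose A *v y - z"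
  define g where "g = (\<beta>\<^sub>1 * (x \<bullet> z / real CARD('n))) *\<^sub>R vec 1 - diag x *v z"
  \<comment> \<open>The diagonal of the inverse of \<open>\<rho> I + X^{-1} Z\<close>, the block
    multiplying \<open>dx\<close> once \<open>dz\<close> is eliminated.\<close>
  define D where "D = (\<chi> i. 1 / (\<rho> + z $ i / x $ i))"
  define h where "h = (\<chi> i. f $ i - g $ i / x $ i)"
  have D: "0 < D $ i" "D $ i * (\<rho> + z $ i / x $ i) = 1" for i
  proof -
    have "0 < \<rho> + z $ i / x $ i" using par pos by (simp add: add_pos_pos)
    then show "0 < D $ i" "D $ i * (\<rho> + z $ i / x $ i) = 1" by (simp_all add: D_def)
  qed
  define S where "S = (\<lambda>v. A *v (diag D *v (transpose A *v v)) + \<delta> *\<^sub>R v)"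
  have lin: "linear S"
    unfolding S_def
    by (rule linearI) (simp_all add: matrix_vector_right_distrib matrix_vector_mult_scaleR
        scaleR_add_right del: transpose_matrix_vector)
  have "inj S"
    unfolding linear_injective_0[OF lin]
  proof (intro allI impI)
    fix v assume "S v = 0"
    then have "0 = S v \<bullet> v" by simp
    also have "\<dots> = (diag D *v (transpose A *v v)) \<bullet> (transpose A *v v) + \<delta> * (v \<bullet> v)"
      by (simp add: S_def inner_add_left inner_transpose_mult del: transpose_matrix_vector)
    finally have sum0: "(diag D *v (transpose A *v v)) \<bullet> (transpose A *v v) + \<delta> * (v \<bullet> v) = 0" ..
    have "0 \<le> (diag D *v (transpose A *v v)) \<bullet> (transpose A *v v)"
      unfolding inner_vec_sum diag_mult_nth
      using D(1) by (intro sum_nonneg) (simp add: mult.assoc less_imp_le del: transpose_matrix_vector)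
    then have "\<delta> * (v \<bullet> v) \<le> 0" using sum0 by linarith
    then have "v \<bullet> v \<le> 0" using par by (simp add: mult_le_0_iff)
    then show "v = 0" by (metis inner_gt_zero_iff not_le)
  qed
  then have "surj S" using linear_injective_imp_surjective[OF lin] by simp
  then obtain dy where dy: "S dy = b - A *v x + A *v (diag D *v h)" by (metis surjD)
  define dx where "dx = diag D *v (transpose A *v dy - h)"
  define dz where "dz = (\<chi> i. (g $ i - z $ i * dx $ i) / x $ i)"
  have e1: "A *v dx + \<delta> *\<^sub>R dy = b - A *v x"
    using dy by (simp add: S_def dx_def matrix_vector_mult_diff_distrib algebra_simps
        del: transpose_matrix_vector)
  have e2: "- (\<rho> *\<^sub>R dx) + transpose A *v dy + dz = f"
  proof (rule vec_eq_iff[THEN iffD2], rule allI)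
    fix i
    have "(\<rho> + z $ i / x $ i) * dx $ i
        = (D $ i * (\<rho> + z $ i / x $ i)) * (transpose A *v dy - h) $ i"
      by (simp add: dx_def del: transpose_matrix_vector)
    also have "\<dots> = (transpose A *v dy - h) $ i" using D(2) by simp
    finally have "\<rho> * dx $ i + z $ i / x $ i * dx $ i
        = (transpose A *v dy) $ i - (f $ i - g $ i / x $ i)"
      by (simp add: h_def algebra_simps del: transpose_matrix_vector)
    then show "(- (\<rho> *\<^sub>R dx) + transpose A *v dy + dz) $ i = f $ i"
      by (simp add: dz_def diff_divide_distrib del: transpose_matrix_vector)
  qed
  have e3: "diag z *v dx + diag x *v dz = g"
    unfolding vec_eq_iff using pos(1) by (auto simp: dz_def less_imp_neq[THEN not_sym])
  have "search_direction w (dx, dy, dz)"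
    unfolding search_direction_def wf split_beta fst_conv snd_conv
    \<comment> \<open>Zero residuals \<open>r\<close> and \<open>s\<close> are allowed because
      \<open>\<tau>\<^sub>1\<close> and \<open>\<tau>\<^sub>2\<close> are at most 1.\<close>
    by (rule exI[of _ 0], rule exI[of _ 0])
       (use e1 e2 e3 par in \<open>simp add: f_def g_def del: transpose_matrix_vector\<close>)
  then show ?thesis ..
qed

end

section \<open>Choice of the regularization bounds and of a uniform step-length\<close>

lemma inner_le_norm1_mult: "x \<bullet> z \<le> norm1 x * norm1 z"
proof -
  have "norm x \<le> norm1 x" "norm z \<le> norm1 z"
    by (simp_all add: norm1_def norm_le_l1_cart)
  then have "norm x * norm z \<le> norm1 x * norm1 z"
    using norm_ge_zero[of x] by (intro mult_mono) (linarith | simp)+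
  then show ?thesis using norm_cauchy_schwarz[of x z] by linarith
qed

lemma component_le_norm1: "v $ i \<le> norm1 v"
proof -
  have "\<bar>v $ i\<bar> \<le> norm1 v" unfolding norm1_def by (rule member_le_sum) auto
  then show ?thesis by simp
qed

text \<open>Before a stop in step 1 the iterates lie in a region fixed in advance, and the direction
  bound \<open>C\<close> there is valid for all \<open>\<rho> \<le> 1\<close> and all positive
  \<delta>. Hence \<open>\<rho>\<^sub>0\<close>, \<open>\<delta>\<^sub>0\<close> and
  \<open>a\<close> can be chosen after \<open>C\<close> without circularity.\<close>

lemma uniform_step:
  fixes A :: "real ^ 'n::finite ^ 'm::finite"
    and b :: "real ^ 'm"
    and c :: "real ^ 'n"
    and \<omega> \<epsilon> \<epsilon>\<^sub>p \<epsilon>\<^sub>d \<gamma> \<gamma>\<^sub>p \<gamma>\<^sub>d \<beta>\<^sub>1 \<beta>\<^sub>2 \<tau>\<^sub>1 \<tau>\<^sub>2 :: real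
  assumes xf: "A *v xf = b" and \<omega>: "0 < \<omega>"
    and par: "0 < \<epsilon>" "0 < \<epsilon>\<^sub>p" "0 < \<epsilon>\<^sub>d" "0 < \<gamma>" "\<gamma> < 1" "0 < \<gamma>\<^sub>p" "0 < \<gamma>\<^sub>d"
    and \<beta>: "0 < \<beta>\<^sub>1" "\<beta>\<^sub>1 < 1" "\<beta>\<^sub>1 < \<beta>\<^sub>2"
    and \<tau>: "0 < \<tau>\<^sub>1" "\<tau>\<^sub>1 \<le> 1" "0 < \<tau>\<^sub>2" "\<tau>\<^sub>2 \<le> 1" "0 < \<beta>\<^sub>1 + \<tau>\<^sub>1 - 1" "0 < \<beta>\<^sub>1 + \<tau>\<^sub>2 - 1"
  obtains \<rho>\<^sub>0 \<delta>\<^sub>0 a where "0 < \<rho>\<^sub>0" "0 < \<delta>\<^sub>0" "0 < a" "a \<le> 1"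
    "\<And>\<rho> \<delta> w d \<alpha>. \<lbrakk>0 < \<rho>; \<rho> \<le> \<rho>\<^sub>0; 0 < \<delta>; \<delta> \<le> \<delta>\<^sub>0; w \<in> ipm.neighborhood A b c \<epsilon>\<^sub>p \<epsilon>\<^sub>d \<gamma> \<gamma>\<^sub>p \<gamma>\<^sub>d;
        \<not> ipm.stops_at_step1 A b c \<omega> \<epsilon> \<epsilon>\<^sub>p \<epsilon>\<^sub>d w;
        ipm.search_direction A b c \<beta>\<^sub>1 \<tau>\<^sub>1 \<tau>\<^sub>2 \<rho> \<delta> w d; 0 \<le> \<alpha>; \<alpha> \<le> a\<rbrakk>
      \<Longrightarrow> ipm.admissible_step A b c \<epsilon>\<^sub>p \<epsilon>\<^sub>d \<gamma> \<gamma>\<^sub>p \<gamma>\<^sub>d \<beta>\<^sub>2 w d \<alpha>"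
proof -
  \<comment> \<open>The regularization parameters stay variable, as the constants below must not
    depend on them.\<close>
  interpret ipm A b c \<omega> \<epsilon> \<epsilon>\<^sub>p \<epsilon>\<^sub>d \<gamma> \<gamma>\<^sub>p \<gamma>\<^sub>d \<beta>\<^sub>1 \<beta>\<^sub>2 \<beta>\<^sub>3 \<tau>\<^sub>1 \<tau>\<^sub>2 \<rho> \<delta> for \<beta>\<^sub>3 \<rho> \<delta> .
  define n where "n = real CARD('n)"
  define e where "e = min \<epsilon> (min (\<gamma>\<^sub>p * \<epsilon>\<^sub>p) (\<gamma>\<^sub>d * \<epsilon>\<^sub>d))"
  \<comment> \<open>From \<open>x $ i * z $ i \<ge> \<gamma> * (e / n)\<close>, with the other
    factor at most \<omega>.\<close>
  define \<eta> where "\<eta> = \<gamma> * (e / n) / \<omega>"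
  define Rp where "Rp = \<epsilon>\<^sub>p + \<omega>\<^sup>2 / \<gamma>\<^sub>p"
  define Rd where "Rd = \<epsilon>\<^sub>d + \<omega>\<^sup>2 / \<gamma>\<^sub>d"
  \<comment> \<open>One radius for three right-hand sides: \<open>Rp\<close> for \<open>r\<close>,
    \<open>2 * Rd\<close> for the dual residual plus \<open>s\<close>, and
    \<open>2 * \<omega>\<^sup>2\<close> for the complementarity row, whose norm is at most twice the
    gap.\<close>
  define R where "R = Rp + 2 * Rd + 2 * \<omega>\<^sup>2"
  have n: "1 \<le> n" unfolding n_def by (simp add: Suc_le_eq)
  have e: "0 < e" using par by (simp add: e_def)
  have \<eta>: "0 < \<eta>" using par e n \<omega> by (simp add: \<eta>_def)
  have Rpd: "0 \<le> Rp" "0 \<le> Rd" using par by (simp_all add: Rp_def Rd_def)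
  have R: "0 \<le> R" "Rp \<le> R" "2 * Rd \<le> R" "2 * \<omega>\<^sup>2 \<le> R" using Rpd by (simp_all add: R_def)
  obtain C where C: "0 < C" and bound:
    "\<And>\<rho> \<delta> x z dx dy dz r f g. \<lbrakk>0 \<le> \<rho>; \<rho> \<le> 1; 0 \<le> \<delta>; \<And>i. \<eta> \<le> x $ i; \<And>i. x $ i \<le> \<omega>;
       \<And>i. \<eta> \<le> z $ i; \<And>i. z $ i \<le> \<omega>; norm r \<le> R; norm f \<le> R; norm g \<le> R;
       A *v dx + \<delta> *\<^sub>R dy = b - A *v x + r; - (\<rho> *\<^sub>R dx) + transpose A *v dy + dz = f;
       \<And>i. z $ i * dx $ i + x $ i * dz $ i = g $ i\<rbrakk>
     \<Longrightarrow> norm dx \<le> C \<and> norm dz \<le> C \<and> norm (r - \<delta> *\<^sub>R dy) \<le> norm r + \<delta> * C"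
    using uniform_direction_bound[OF xf \<eta> \<omega> R(1)] by blast
  \<comment> \<open>The 1 meets the assumption of the direction bound; the other terms make
    \<open>\<rho> * C\<close> and \<open>\<delta> * C\<close> small enough to serve as
    \<open>D\<^sub>2\<close> and \<open>D\<^sub>1\<close>.\<close>
  define \<rho>\<^sub>0 where "\<rho>\<^sub>0 = min 1 (min (\<tau>\<^sub>2 * \<epsilon>\<^sub>d / C) (e * (\<beta>\<^sub>1 + \<tau>\<^sub>2 - 1) / 2 / (\<gamma>\<^sub>d * C)))"
  define \<delta>\<^sub>0 where "\<delta>\<^sub>0 = min (\<tau>\<^sub>1 * \<epsilon>\<^sub>p / C) (e * (\<beta>\<^sub>1 + \<tau>\<^sub>1 - 1) / 2 / (\<gamma>\<^sub>p * C))"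
  define M where "M = min (min (e * (\<beta>\<^sub>2 - \<beta>\<^sub>1)) ((1 - \<gamma>) * \<beta>\<^sub>1 * (e / n) / 2))
     (min (e * (\<beta>\<^sub>1 + \<tau>\<^sub>1 - 1) / 2) (e * (\<beta>\<^sub>1 + \<tau>\<^sub>2 - 1) / 2))"
  define a where "a = min 1 (min (\<eta> / 2 / C) (M / C\<^sup>2))"
  have M: "0 < M" using e n par \<beta> \<tau> by (simp add: M_def)
  show thesis
  proof (rule that[of \<rho>\<^sub>0 \<delta>\<^sub>0 a])
    show "0 < \<rho>\<^sub>0" "0 < \<delta>\<^sub>0" using C e par \<tau> by (simp_all add: \<rho>\<^sub>0_def \<delta>\<^sub>0_def)
    show "0 < a" "a \<le> 1" using C \<eta> M by (simp_all add: a_def)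
    fix \<rho> \<delta> w d \<alpha>
    assume \<rho>: "0 < \<rho>" "\<rho> \<le> \<rho>\<^sub>0" and \<delta>: "0 < \<delta>" "\<delta> \<le> \<delta>\<^sub>0" and w: "w \<in> neighborhood"
      and nostop: "\<not> stops_at_step1 w" and d: "search_direction \<rho> \<delta> w d"
      and \<alpha>: "0 \<le> \<alpha>" "\<alpha> \<le> a"
    obtain x y z where wf: "w = (x, y, z)" by (cases w)
    obtain dx dy dz where df: "d = (dx, dy, dz)" by (cases d)
    define G where "G = x \<bullet> z"
    have nb: "(x, y, z) \<in> neighborhood" using w by (simp add: wf)
    have pos: "0 < x $ i" "0 < z $ i" for i using nb by (auto simp: neighborhood_def pos_vec_def)
    have "norm1 x + norm1 z \<le> \<omega>" "\<not> is_solution w"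
      using nostop by (simp_all add: stops_at_step1_def wf)
    moreover have "0 \<le> norm1 x" "0 \<le> norm1 z" by (simp_all add: norm1_def sum_nonneg)
    ultimately have norm1: "norm1 x \<le> \<omega>" "norm1 z \<le> \<omega>" "0 \<le> norm1 x" "0 \<le> norm1 z"
      and nosol: "\<not> is_solution w" by linarith+
    have upper: "x $ i \<le> \<omega>" "z $ i \<le> \<omega>" for i
      using component_le_norm1[of x i] component_le_norm1[of z i] norm1 by linarith+
    have G_le: "G \<le> \<omega>\<^sup>2"
    proof -
      have "norm1 x * norm1 z \<le> \<omega> * \<omega>" using norm1 \<omega> by (intro mult_mono) auto
      then show ?thesis
        using inner_le_norm1_mult[of x z] by (simp add: G_def power2_eq_square)
    qed
    have e_le: "e \<le> G"
      using gap_lower_bound[OF w nosol \<open>0 < \<gamma>\<^sub>p\<close> \<open>0 < \<gamma>\<^sub>d\<close>] by (simp add: e_def G_def wf)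
    have prod: "\<gamma> * (e / n) \<le> x $ i * z $ i" for i
    proof -
      have "\<gamma> * (e / n) \<le> \<gamma> * G / n"
        using e_le par n by (simp add: divide_right_mono)
      also have "\<dots> \<le> x $ i * z $ i" using nb by (simp add: neighborhood_def G_def n_def)
      finally show ?thesis .
    qed
    have lower: "\<eta> \<le> x $ i" "\<eta> \<le> z $ i" for i
    proof -
      have "x $ i * z $ i \<le> x $ i * \<omega>" "x $ i * z $ i \<le> \<omega> * z $ i"
        using upper[of i] pos[of i] by (auto intro: mult_left_mono mult_right_mono)
      then have "\<gamma> * (e / n) \<le> x $ i * \<omega>" "\<gamma> * (e / n) \<le> \<omega> * z $ i"
        using prod[of i] by linarith+
      then show "\<eta> \<le> x $ i" "\<eta> \<le> z $ i"
        unfolding \<eta>_def pos_divide_le_eq[OF \<omega>] by (simp_all only: mult.commute[of \<omega>])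
    qed
    obtain r s where r: "norm r \<le> (1 - \<tau>\<^sub>1) * norm (A *v x - b)"
      and s: "norm s \<le> (1 - \<tau>\<^sub>2) * norm (transpose A *v y + z - c)"
      and e1: "A *v dx + \<delta> *\<^sub>R dy = b - A *v x + r"
      and e2: "- (\<rho> *\<^sub>R dx) + transpose A *v dy + dz = c - transpose A *v y - z + s"
      and e3: "diag z *v dx + diag x *v dz = (\<beta>\<^sub>1 * (x \<bullet> z / n)) *\<^sub>R vec 1 - diag x *v z"
      using d unfolding search_direction_def wf df n_def by blast
    have newton: "z $ i * dx $ i + x $ i * dz $ i = \<beta>\<^sub>1 * (x \<bullet> z / n) - x $ i * z $ i" for i
      using arg_cong[OF e3, of "\<lambda>v. v $ i"] by simp
    have resid_le: "t \<le> u + \<omega>\<^sup>2 / k" if "k * t \<le> G \<or> t \<le> u" "0 < k" "0 < u" for t u k :: real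
    proof -
      have "t \<le> \<omega>\<^sup>2 / k" if "k * t \<le> G"
        using that G_le \<open>0 < k\<close> by (simp add: pos_le_divide_eq mult.commute)
      moreover have "0 \<le> \<omega>\<^sup>2 / k" using that by simp
      ultimately show ?thesis using that(1,3) by argo
    qed
    have Ap: "norm (A *v x - b) \<le> Rp"
      unfolding Rp_def by (rule resid_le) (use nb par in \<open>auto simp: neighborhood_def G_def\<close>)
    have Ad: "norm (transpose A *v y + z - c) \<le> Rd"
      unfolding Rd_def by (rule resid_le) (use nb par in \<open>auto simp: neighborhood_def G_def\<close>)
    have shrink: "(1 - \<tau>) * norm v \<le> norm v" if "0 < \<tau>" "\<tau> \<le> 1" for \<tau> and v :: "'v::real_normed_vector"
      using that by (intro mult_left_le_one_le) auto
    have rR: "norm r \<le> R" using r Ap shrink[OF \<tau>(1,2), of "A *v x - b"] R by linarith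
    have fR: "norm (c - transpose A *v y - z + s) \<le> R"
    proof -
      have "c - transpose A *v y - z + s = s - (transpose A *v y + z - c)" by simp
      then have "norm (c - transpose A *v y - z + s) \<le> norm s + norm (transpose A *v y + z - c)"
        by (metis norm_triangle_ineq4)
      then show ?thesis
        using s Ad shrink[OF \<tau>(3,4), of "transpose A *v y + z - c"] R by linarith
    qed
    define g where "g = (\<chi> i. \<beta>\<^sub>1 * (x \<bullet> z / n) - x $ i * z $ i)"
    have gR: "norm g \<le> R"
    proof -
      have G0: "0 \<le> G / n" using e e_le n by simp
      have "norm g \<le> (\<Sum>i\<in>UNIV. \<bar>g $ i\<bar>)" by (rule norm_le_l1_cart)
      also have "\<dots> \<le> (\<Sum>i\<in>UNIV. G / n + x $ i * z $ i)"
      proof (rule sum_mono)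
        fix i
        have "0 \<le> \<beta>\<^sub>1 * (G / n)" using \<beta> G0 by (intro mult_nonneg_nonneg) auto
        moreover have "\<beta>\<^sub>1 * (G / n) \<le> G / n" using \<beta> G0 by (intro mult_left_le_one_le) auto
        moreover have "0 < x $ i * z $ i" using pos[of i] by simp
        ultimately show "\<bar>g $ i\<bar> \<le> G / n + x $ i * z $ i"
          unfolding g_def G_def by simp
      qed
      also have "\<dots> = G + G"
        using n by (simp add: sum.distrib n_def[symmetric] inner_vec_sum[of x z, folded G_def])
      finally show ?thesis using G_le R by linarith
    qed
    have "norm dx \<le> C \<and> norm dz \<le> C \<and> norm (r - \<delta> *\<^sub>R dy) \<le> norm r + \<delta> * C"
      by (rule bound[OF _ _ _ lower(1) upper(1) lower(2) upper(2) rR fR gR e1 e2])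
        (use \<rho> \<delta> newton in \<open>auto simp: g_def \<rho>\<^sub>0_def\<close>)
    then have dC: "norm dx \<le> C" "norm dz \<le> C" and rC: "norm (r - \<delta> *\<^sub>R dy) \<le> norm r + \<delta> * C"
      by auto
    have primal: "norm (A *v (x + dx) - b) \<le> (1 - \<tau>\<^sub>1) * norm (A *v x - b) + \<delta> * C"
    proof -
      have "A *v (x + dx) - b = r - \<delta> *\<^sub>R dy"
        using e1 by (simp add: matrix_vector_right_distrib algebra_simps)
      then have "norm (A *v (x + dx) - b) = norm (r - \<delta> *\<^sub>R dy)" by (rule arg_cong)
      then show ?thesis using rC r by linarith
    qed
    have dual: "norm (transpose A *v (y + dy) + (z + dz) - c)
        \<le> (1 - \<tau>\<^sub>2) * norm (transpose A *v y + z - c) + \<rho> * C"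
    proof -
      have "transpose A *v (y + dy) + (z + dz) - c = s + \<rho> *\<^sub>R dx"
        using e2 by (simp add: matrix_vector_right_distrib algebra_simps del: transpose_matrix_vector)
      then have "norm (transpose A *v (y + dy) + (z + dz) - c) \<le> norm s + \<rho> * norm dx"
        using norm_triangle_ineq[of s "\<rho> *\<^sub>R dx"] \<rho> by simp
      moreover have "\<rho> * norm dx \<le> \<rho> * C" using dC \<rho> by simp
      ultimately show ?thesis using s by linarith
    qed
    have D1: "\<delta> * C \<le> \<tau>\<^sub>1 * \<epsilon>\<^sub>p" "\<gamma>\<^sub>p * (\<delta> * C) \<le> e * (\<beta>\<^sub>1 + \<tau>\<^sub>1 - 1) / 2"
    proof -
      have "\<delta> \<le> \<tau>\<^sub>1 * \<epsilon>\<^sub>p / C" "\<delta> \<le> e * (\<beta>\<^sub>1 + \<tau>\<^sub>1 - 1) / 2 / (\<gamma>\<^sub>p * C)"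
        using \<delta> by (simp_all only: \<delta>\<^sub>0_def min.bounded_iff)
      then show "\<delta> * C \<le> \<tau>\<^sub>1 * \<epsilon>\<^sub>p" "\<gamma>\<^sub>p * (\<delta> * C) \<le> e * (\<beta>\<^sub>1 + \<tau>\<^sub>1 - 1) / 2"
        using C par by (simp_all only: pos_le_divide_eq mult_pos_pos mult_ac)
    qed
    have D2: "\<rho> * C \<le> \<tau>\<^sub>2 * \<epsilon>\<^sub>d" "\<gamma>\<^sub>d * (\<rho> * C) \<le> e * (\<beta>\<^sub>1 + \<tau>\<^sub>2 - 1) / 2"
    proof -
      have "\<rho> \<le> \<tau>\<^sub>2 * \<epsilon>\<^sub>d / C" "\<rho> \<le> e * (\<beta>\<^sub>1 + \<tau>\<^sub>2 - 1) / 2 / (\<gamma>\<^sub>d * C)"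
        using \<rho> by (simp_all only: \<rho>\<^sub>0_def min.bounded_iff)
      then show "\<rho> * C \<le> \<tau>\<^sub>2 * \<epsilon>\<^sub>d" "\<gamma>\<^sub>d * (\<rho> * C) \<le> e * (\<beta>\<^sub>1 + \<tau>\<^sub>2 - 1) / 2"
        using C par by (simp_all only: pos_le_divide_eq mult_pos_pos mult_ac)
    qed
    have \<alpha>_le: "\<alpha> \<le> 1" "\<alpha> * C \<le> \<eta> / 2" "\<alpha> * C\<^sup>2 \<le> M"
      using \<alpha>(2) C by (simp_all only: a_def min.bounded_iff pos_le_divide_eq zero_less_power)
    show "admissible_step w d \<alpha>"
      unfolding wf df
    proof (rule admissible_step_if_small[OF nb e e_le[unfolded G_def] \<eta> lower
          \<open>0 < \<epsilon>\<^sub>p\<close> \<open>0 < \<epsilon>\<^sub>d\<close> \<open>0 < \<gamma>\<close> \<open>\<gamma> < 1\<close> \<open>0 < \<gamma>\<^sub>p\<close> \<open>0 < \<gamma>\<^sub>d\<close> \<open>0 < \<beta>\<^sub>1\<close> \<tau> C dC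
          newton[unfolded n_def] primal dual D1 D2 \<alpha>(1) \<alpha>_le(1,2)])
    qed (use \<alpha>_le(3) in \<open>simp_all only: M_def min.bounded_iff n_def\<close>)
  qed
qed

section \<open>Geometric decrease of the gap and termination\<close>

theorem theorem2p3:
  fixes A :: "real ^ 'n::finite ^ 'm::finite"
    and b :: "real ^ 'm"
    and c :: "real ^ 'n"
    and \<omega> \<epsilon> \<epsilon>\<^sub>p \<epsilon>\<^sub>d \<gamma> \<gamma>\<^sub>p \<gamma>\<^sub>d \<beta>\<^sub>1 \<beta>\<^sub>2 \<beta>\<^sub>3 \<tau>\<^sub>1 \<tau>\<^sub>2 :: real
    and w\<^sub>0 :: "('n, 'm) point"
  assumes "\<exists>w. strictly_feasible A b c w"
    and "\<omega> > 1"
    and "\<epsilon> > 0" and "\<epsilon>\<^sub>p > 0" and "\<epsilon>\<^sub>d > 0"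
    and "0 < \<gamma>" and "\<gamma> < 1" and "\<gamma>\<^sub>p > 0" and "\<gamma>\<^sub>d > 0"
    and "0 < \<beta>\<^sub>1" and "\<beta>\<^sub>1 < \<beta>\<^sub>2" and "\<beta>\<^sub>2 < \<beta>\<^sub>3" and "\<beta>\<^sub>3 < 1"
    and "0 < \<tau>\<^sub>1" and "\<tau>\<^sub>1 \<le> 1" and "0 < \<tau>\<^sub>2" and "\<tau>\<^sub>2 \<le> 1"
    and "\<beta>\<^sub>1 + \<tau>\<^sub>1 - 1 > 0" and "\<beta>\<^sub>1 + \<tau>\<^sub>2 - 1 > 0"
    and "w\<^sub>0 \<in> ipm.neighborhood A b c \<epsilon>\<^sub>p \<epsilon>\<^sub>d \<gamma> \<gamma>\<^sub>p \<gamma>\<^sub>d"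
  shows "\<exists>\<rho>\<^sub>0>0. \<exists>\<delta>\<^sub>0>0. \<forall>\<rho> \<delta>. 0 < \<rho> \<and> \<rho> \<le> \<rho>\<^sub>0 \<and> 0 < \<delta> \<and> \<delta> \<le> \<delta>\<^sub>0 \<longrightarrow>
    ipm.terminates_from A b c \<omega> \<epsilon> \<epsilon>\<^sub>p \<epsilon>\<^sub>d \<gamma> \<gamma>\<^sub>p \<gamma>\<^sub>d \<beta>\<^sub>1 \<beta>\<^sub>2 \<beta>\<^sub>3 \<tau>\<^sub>1 \<tau>\<^sub>2 \<rho> \<delta> w\<^sub>0"
proof -
  obtain xf where xf: "A *v xf = b"
    using assms(1) by (auto simp: strictly_feasible_def)
  note par = \<open>0 < \<epsilon>\<close> \<open>0 < \<epsilon>\<^sub>p\<close> \<open>0 < \<epsilon>\<^sub>d\<close> \<open>0 < \<gamma>\<close> \<open>0 < \<gamma>\<^sub>p\<close> \<open>0 < \<gamma>\<^sub>d\<close>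
  have "0 < \<omega>" "\<beta>\<^sub>1 < 1" using assms by linarith+
  then obtain \<rho>\<^sub>0 \<delta>\<^sub>0 a where pos: "0 < \<rho>\<^sub>0" "0 < \<delta>\<^sub>0" and a: "0 < a" "a \<le> 1" and step:
    "\<And>\<rho> \<delta> w d \<alpha>. \<lbrakk>0 < \<rho>; \<rho> \<le> \<rho>\<^sub>0; 0 < \<delta>; \<delta> \<le> \<delta>\<^sub>0; w \<in> ipm.neighborhood A b c \<epsilon>\<^sub>p \<epsilon>\<^sub>d \<gamma> \<gamma>\<^sub>p \<gamma>\<^sub>d;
        \<not> ipm.stops_at_step1 A b c \<omega> \<epsilon> \<epsilon>\<^sub>p \<epsilon>\<^sub>d w;
        ipm.search_direction A b c \<beta>\<^sub>1 \<tau>\<^sub>1 \<tau>\<^sub>2 \<rho> \<delta> w d; 0 \<le> \<alpha>; \<alpha> \<le> a\<rbrakk>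
      \<Longrightarrow> ipm.admissible_step A b c \<epsilon>\<^sub>p \<epsilon>\<^sub>d \<gamma> \<gamma>\<^sub>p \<gamma>\<^sub>d \<beta>\<^sub>2 w d \<alpha>"
    using uniform_step[OF xf, of \<omega> \<epsilon> \<epsilon>\<^sub>p \<epsilon>\<^sub>d \<gamma> \<gamma>\<^sub>p \<gamma>\<^sub>d \<beta>\<^sub>1 \<beta>\<^sub>2 \<tau>\<^sub>1 \<tau>\<^sub>2 c] assms by metis
  have "ipm.terminates_from A b c \<omega> \<epsilon> \<epsilon>\<^sub>p \<epsilon>\<^sub>d \<gamma> \<gamma>\<^sub>p \<gamma>\<^sub>d \<beta>\<^sub>1 \<beta>\<^sub>2 \<beta>\<^sub>3 \<tau>\<^sub>1 \<tau>\<^sub>2 \<rho> \<delta> w\<^sub>0"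
    if reg: "0 < \<rho>" "\<rho> \<le> \<rho>\<^sub>0" "0 < \<delta>" "\<delta> \<le> \<delta>\<^sub>0" for \<rho> \<delta>
  proof -
    interpret ipm A b c \<omega> \<epsilon> \<epsilon>\<^sub>p \<epsilon>\<^sub>d \<gamma> \<gamma>\<^sub>p \<gamma>\<^sub>d \<beta>\<^sub>1 \<beta>\<^sub>2 \<beta>\<^sub>3 \<tau>\<^sub>1 \<tau>\<^sub>2 \<rho> \<delta> .
    \<comment> \<open>The contraction factor of the gap: every step-length of step 5 is at least
      \<open>a\<close>.\<close>
    define q where "q = 1 - a * (1 - \<beta>\<^sub>3)"
    define e where "e = min \<epsilon> (min (\<gamma>\<^sub>p * \<epsilon>\<^sub>p) (\<gamma>\<^sub>d * \<epsilon>\<^sub>d))"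
    have e: "0 < e" using par by (simp add: e_def)
    have q: "0 \<le> q" "q < 1"
    proof -
      have "a * (1 - \<beta>\<^sub>3) \<le> 1" using a assms by (intro mult_le_one) auto
      then show "0 \<le> q" "q < 1" using a assms by (simp_all add: q_def)
    qed
    have nb: "w' \<in> neighborhood" if "iteration w d w'" for w d w'
      using that by (auto simp: iteration_def next_iterate_def split: prod.splits)
    have decrease: "gap w' \<le> q * gap w" if w: "w \<in> neighborhood" and it: "iteration w d w'" for w d w'
    proof -
      have it': "\<not> stops_at_step1 w" "search_direction w d" "\<not> stops_at_step4 w d"
        "next_iterate w d w'" using it by (auto simp: iteration_def)
      have "a \<le> alpha_bar w d"
        using alpha_bar_greatest(4)[OF w par it'(3)] a step[OF reg w it'(1,2)] by simp
      then have "1 - alpha_bar w d * (1 - \<beta>\<^sub>3) \<le> q"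
        using assms(13) by (simp add: q_def mult_right_mono)
      then have "(1 - alpha_bar w d * (1 - \<beta>\<^sub>3)) * gap w \<le> q * gap w"
        using gap_pos[OF w] by (intro mult_right_mono) auto
      moreover have "gap w' \<le> (1 - alpha_bar w d * (1 - \<beta>\<^sub>3)) * gap w"
        using it'(4) by (cases w; cases d) (simp add: next_iterate_def)
      ultimately show ?thesis by linarith
    qed
    have no_infinite: False
      if w0: "w 0 = w\<^sub>0" and it: "\<And>k::nat. iteration (w k) (d k) (w (Suc k))" for w d
    proof -
      \<comment> \<open>A case distinction suffices, since \<open>next_iterate\<close> itself puts
        each new point into the neighborhood.\<close>
      have wnb: "w k \<in> neighborhood" for k
        by (cases k) (use w0 assms(20) nb[OF it] in simp_all)
      have geometric: "gap (w k) \<le> q ^ k * gap w\<^sub>0" for k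
      proof (induction k)
        case (Suc k)
        have "gap (w (Suc k)) \<le> q * gap (w k)" by (rule decrease[OF wnb it])
        also have "\<dots> \<le> q * (q ^ k * gap w\<^sub>0)" using Suc q by (intro mult_left_mono)
        finally show ?case by simp
      qed (simp add: w0)
      have g0: "0 < gap w\<^sub>0" using gap_pos[OF wnb[of 0]] by (simp add: w0)
      then obtain k where "q ^ k < e / gap w\<^sub>0"
        using real_arch_pow_inv[of "e / gap w\<^sub>0" q] e q by auto
      then have "q ^ k * gap w\<^sub>0 < e" using g0 by (simp add: pos_less_divide_eq)
      moreover have "e \<le> gap (w k)"
      \<comment> \<open>An infinite run never meets a solution, so its gaps stay above
        \<open>e\<close>, against the geometric decay.\<close>
      proof -
        have "\<not> is_solution (w k)"
          using it[of k] by (auto simp: iteration_def stops_at_step1_def split: prod.splits)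
        then show ?thesis
          using gap_lower_bound[OF wnb] par by (simp add: e_def)
      qed
      ultimately show False using geometric[of k] by linarith
    qed
    have progress: "(\<exists>d\<^sub>N. search_direction (w N) d\<^sub>N) \<and>
        (\<forall>d\<^sub>N. search_direction (w N) d\<^sub>N \<and> \<not> stops_at_step4 (w N) d\<^sub>N \<longrightarrow>
           (\<exists>w'. next_iterate (w N) d\<^sub>N w'))"
      if "w 0 = w\<^sub>0" "\<forall>k<N. iteration (w k) (d k) (w (Suc k))" for w d and N :: nat
    proof -
      have "w N \<in> neighborhood"
        by (cases N) (use that assms(20) nb[OF that(2)[rule_format]] in simp_all)
      then show ?thesis
        using search_direction_exists next_iterate_exists par reg assms by simp
    qed
    show ?thesis
      unfolding terminates_from_def using no_infinite progress by blast
  qed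
  then show ?thesis using pos by blast
qed

end
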